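(* Let $T>0$, $\gamma\in(1/2,1)$, $\kappa\in(0,1)$ with $\gamma(\kappa+1)<1$. Let $\sigma:\mathbb{R}\to\mathbb{R}$ satisfy: $\sigma(0)=0$; $|\sigma(\xi_2)-\sigma(\xi_1)|\le C\,\big||\xi_2|^\kappa-|\xi_1|^\kappa\big|$ for all $\xi_1,\xi_2\in\mathbb{R}$ and some constant $C$; $\sigma$ is continuous and increasing on $\mathbb{R}_+$; and $1/\sigma$ is integrable on compact neighborhoods of zero. Let $\eta$ be such that $\frac{1-\gamma(1+\kappa)}{\gamma}<\eta<1-\kappa$. Let $\phi(\xi)=\int_0^\xi\frac{ds}{\sigma(s)}$, $\xi\in\mathbb{R}$, and let $\phi^{-1}$ be its inverse. Suppose that $x\in\mathcal{C}^\gamma([0,T];\mathbb{R})$ is such that $x_0=0$ and $|\phi^{-1}(x)|^{-\eta}\in L^1([0,T])$. Then the function $y=\phi^{-1}(x)$ is a solution of the equation $$y_t=\int_0^t\sigma(y_s)\,dx_s,\qquad t\in[0,T],$$ where the integral is understood in the fractional sense described in the context.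
   Context: Under the stated assumptions $\phi$ is invertible from $\mathbb{R}$ onto $\mathbb{R}$. Fractional integral. For $0\le a<b\le T$, $\alpha\in(0,1)$: $I_{a+}^\alpha f_t=\frac1{\Gamma(\alpha)}\int_a^t(t-r)^{\alpha-1}f_r\,dr$, $I_{b-}^\alpha f_t=\frac1{\Gamma(\alpha)}\int_t^b(r-t)^{\alpha-1}f_r\,dr$; $I_{a+}^\alpha(L^p)$, $I_{b-}^\alpha(L^p)$ denote the images of $L^p([a,b])$. Their inverses are the fractional derivatives $D_{a+}^\alpha f_t=\frac1{\Gamma(1-\alpha)}\Big(\frac{f_t}{(t-a)^\alpha}+\alpha\int_a^t\frac{f_t-f_r}{(t-r)^{1+\alpha}}dr\Big)$ and $D_{b-}^\alpha f_t=\frac1{\Gamma(1-\alpha)}\Big(\frac{f_t}{(b-t)^\alpha}+\alpha\int_t^b\frac{f_t-f_r}{(r-t)^{1+\alpha}}dr\Big)$ (in general the inner integrals are $L^p$-limits of the integrals over $[a,t-\varepsilon]$, resp. $[t+\varepsilon,b]$, as $\varepsilon\downarrow0$, with $f$ extended by $0$ outside $[a,b]$). Let $g^{b-}_r=g_r-g_{b-}$. If for some $\alpha\in(0,1)$ one has $f\in I_{a+}^\alpha(L^1)$, $g^{b-}\in I_{b-}^{1-\alpha}(L^1)$ and $(D_{a+}^\alpha f)\,D_{b-}^{1-\alpha}g^{b-}\in L^1([a,b])$, then $f$ is said to be integrable with respect to $g$ and $\int_a^bf_r\,dg_r:=-\int_a^b(D_{a+}^\alpha f_r)\,D_{b-}^{1-\alpha}g^{b-}_r\,dr$.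 The integral over a degenerate interval is $0$. *)

theory Defs
  imports "HOL-Analysis.Analysis"
begin

definition holder_on :: "real \<Rightarrow> real set \<Rightarrow> (real \<Rightarrow> real) \<Rightarrow> bool" where
  "holder_on \<gamma> S f \<longleftrightarrow> (\<exists>K. \<forall>s\<in>S. \<forall>t\<in>S. \<bar>f t - f s\<bar> \<le> K * \<bar>t - s\<bar> powr \<gamma>)"

(* Integrability of the extended-valued function 1/f, where 1/0 = \<infinity>. As HOL sets 1/0 = 0,
   the zeros of f have to be excluded, up to a null set, by a separate conjunct. *)
definition reciprocal_in_L1 :: "real set \<Rightarrow> (real \<Rightarrow> real) \<Rightarrow> bool" where
  "reciprocal_in_L1 S f \<longleftrightarrow>
     (AE t in lebesgue. t \<in> S \<longrightarrow> f t \<noteq> 0) \<and> set_integrable lebesgue S (\<lambda>t. 1 / f t)"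

(* The integral is oriented: phi \<sigma> \<xi> = - (integral of 1/\<sigma> over [\<xi>,0]) for \<xi> < 0. *)
definition phi :: "(real \<Rightarrow> real) \<Rightarrow> real \<Rightarrow> real" where
  "phi \<sigma> \<xi> = (LBINT s=0..\<xi>. (1 / \<sigma> s))"

definition frac_int_left :: "real \<Rightarrow> real \<Rightarrow> (real \<Rightarrow> real) \<Rightarrow> real \<Rightarrow> real" where
  "frac_int_left \<alpha> a f t =
     1 / Gamma \<alpha> * (LINT r=a..t|lebesgue. ((t - r) powr (\<alpha> - 1) * f r))"

definition frac_int_right :: "real \<Rightarrow> real \<Rightarrow> (real \<Rightarrow> real) \<Rightarrow> real \<Rightarrow> real" where
  "frac_int_right \<alpha> b f t =
     1 / Gamma \<alpha> * (LINT r=t..b|lebesgue. ((r - t) powr (\<alpha> - 1) * f r))"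

(* The images of L^1([a,b]) under the fractional integrals, as spaces of functions
   up to almost everywhere equality on [a,b]. *)
definition frac_image_left :: "real \<Rightarrow> real \<Rightarrow> real \<Rightarrow> (real \<Rightarrow> real) set" where
  "frac_image_left \<alpha> a b =
     {f. \<exists>h. set_integrable lebesgue {a..b} h \<and>
             (AE t in lebesgue. t \<in> {a..b} \<longrightarrow> f t = frac_int_left \<alpha> a h t)}"

definition frac_image_right :: "real \<Rightarrow> real \<Rightarrow> real \<Rightarrow> (real \<Rightarrow> real) set" where
  "frac_image_right \<alpha> a b =
     {f. \<exists>h. set_integrable lebesgue {a..b} h \<and>
             (AE t in lebesgue. t \<in> {a..b} \<longrightarrow> f t = frac_int_right \<alpha> b h t)}"

(* Truncated fractional derivatives on [a,b]; the indicator extends f by 0 outside [a,b].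
   The inner integrals are oriented: for a < t < a + \<epsilon> the left one runs backwards from a
   to t - \<epsilon> and the whole expression reduces to f t / (Gamma (1 - \<alpha>) * \<epsilon> powr \<alpha>);
   symmetrically at b. *)
definition frac_deriv_left_trunc ::
    "real \<Rightarrow> real \<Rightarrow> real \<Rightarrow> real \<Rightarrow> (real \<Rightarrow> real) \<Rightarrow> real \<Rightarrow> real" where
  "frac_deriv_left_trunc \<epsilon> \<alpha> a b f t =
     1 / Gamma (1 - \<alpha>) *
       (f t / (t - a) powr \<alpha> +
        \<alpha> * (LINT r=a..ereal (t - \<epsilon>)|lebesgue.
              ((f t - indicator {a..b} r * f r) / (t - r) powr (1 + \<alpha>))))"

definition frac_deriv_right_trunc ::
    "real \<Rightarrow> real \<Rightarrow> real \<Rightarrow> real \<Rightarrow> (real \<Rightarrow> real) \<Rightarrow> real \<Rightarrow> real" where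
  "frac_deriv_right_trunc \<epsilon> \<alpha> a b f t =
     1 / Gamma (1 - \<alpha>) *
       (f t / (b - t) powr \<alpha> +
        \<alpha> * (LINT r=ereal (t + \<epsilon>)..b|lebesgue.
              ((f t - indicator {a..b} r * f r) / (r - t) powr (1 + \<alpha>))))"

definition L1_limit :: "real \<Rightarrow> real \<Rightarrow> (real \<Rightarrow> real \<Rightarrow> real) \<Rightarrow> (real \<Rightarrow> real) \<Rightarrow> bool" where
  "L1_limit a b F h \<longleftrightarrow>
     set_integrable lebesgue {a..b} h \<and>
     (\<forall>\<epsilon>>0. set_integrable lebesgue {a..b} (F \<epsilon>)) \<and>
     ((\<lambda>\<epsilon>. LINT t:{a..b}|lebesgue. \<bar>F \<epsilon> t - h t\<bar>) \<longlongrightarrow> 0) (at_right 0)"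

(* A fractional derivative is determined only up to a null set, hence a relation between
   f and its derivative h. *)
definition has_frac_deriv_left ::
    "real \<Rightarrow> real \<Rightarrow> real \<Rightarrow> (real \<Rightarrow> real) \<Rightarrow> (real \<Rightarrow> real) \<Rightarrow> bool" where
  "has_frac_deriv_left \<alpha> a b f h \<longleftrightarrow>
     L1_limit a b (\<lambda>\<epsilon>. frac_deriv_left_trunc \<epsilon> \<alpha> a b f) h"

definition has_frac_deriv_right ::
    "real \<Rightarrow> real \<Rightarrow> real \<Rightarrow> (real \<Rightarrow> real) \<Rightarrow> (real \<Rightarrow> real) \<Rightarrow> bool" where
  "has_frac_deriv_right \<alpha> a b f h \<longleftrightarrow>
     L1_limit a b (\<lambda>\<epsilon>. frac_deriv_right_trunc \<epsilon> \<alpha> a b f) h"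

(* f is integrable with respect to g on [a,b] and the integral has the value v.
   The real number gb is the left limit of g at b. *)
definition has_frac_integral ::
    "(real \<Rightarrow> real) \<Rightarrow> (real \<Rightarrow> real) \<Rightarrow> real \<Rightarrow> real \<Rightarrow> real \<Rightarrow> bool" where
  "has_frac_integral f g a b v \<longleftrightarrow>
     (a = b \<and> v = 0) \<or>
     (a < b \<and>
      (\<exists>\<alpha> gb h k. 0 < \<alpha> \<and> \<alpha> < 1 \<and>
         (g \<longlongrightarrow> gb) (at_left b) \<and>
         f \<in> frac_image_left \<alpha> a b \<and>
         (\<lambda>r. g r - gb) \<in> frac_image_right (1 - \<alpha>) a b \<and>
         has_frac_deriv_left \<alpha> a b f h \<and>
         has_frac_deriv_right (1 - \<alpha>) a b (\<lambda>r. g r - gb) k \<and>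
         set_integrable lebesgue {a..b} (\<lambda>r. h r * k r) \<and>
         v = - (LINT r:{a..b}|lebesgue. h r * k r)))"

end

theory Submission
  imports Defs
begin

text \<open>
  Write \<open>\<psi>\<close> for the inverse of \<open>\<phi>\<close>, \<open>y = \<psi> (x)\<close> and \<open>f = \<sigma> (y)\<close>. Since \<open>\<phi>' = 1 / \<sigma>\<close> away
  from \<open>0\<close> and \<open>\<bar>\<xi>\<bar> \<le> \<sigma> \<xi> * \<bar>\<phi> \<xi>\<bar>\<close>, the function \<open>\<psi>\<close> is differentiable on the whole line, with
  \<open>\<psi>' = \<sigma> \<circ> \<psi>\<close> also at \<open>0\<close>. The equation is therefore the chain rule for \<open>\<psi> (x)\<close>, in a
  situation where \<open>\<psi>' (x)\<close> is too irregular for Young integration: it is only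
  Hoelder of order \<open>\<gamma> * \<kappa>\<close>, and \<open>\<gamma> * \<kappa> + \<gamma> < 1\<close>.

  The missing regularity is recovered with a singular weight. For \<open>q \<noteq> 0\<close>,
  \<open>\<bar>\<bar>p\<bar> powr \<kappa> - \<bar>q\<bar> powr \<kappa>\<bar> \<le> \<bar>p - q\<bar> powr (\<kappa> + \<eta>) / \<bar>q\<bar> powr \<eta>\<close>
  (\<open>abs_powr_diff_le\<close>), so that \<open>\<bar>f t - f s\<bar> \<le> m t * \<bar>t - s\<bar> powr (\<gamma> * (\<kappa> + \<eta>))\<close> where \<open>m\<close> is a
  multiple of \<open>\<bar>y\<bar> powr -\<eta>\<close> and hence integrable. The lower bound on \<open>\<eta>\<close> says precisely that
  \<open>1 - \<gamma> < \<gamma> * (\<kappa> + \<eta>)\<close>, which leaves room for an order \<open>\<alpha>\<close> strictly between the two.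

  For such an \<open>\<alpha>\<close>, the weighted Hoelder condition alone makes the truncated derivatives of \<open>f\<close> of
  order \<open>\<alpha>\<close> converge in \<open>L\<^sup>1\<close> to a limit \<open>D\<close>, and \<open>f\<close> is the fractional integral of \<open>D\<close>
  (\<open>inversion\<close>). The latter is first proved after one integration: by Fubini, the primitive of
  \<open>D\<close> is the fractional integral of \<open>f\<close> of order \<open>1 - \<alpha>\<close> (\<open>primitive_D\<close>), and the semigroup law of
  fractional integrals does the rest. After the reflection \<open>r \<mapsto> b - r\<close> the same results apply to
  \<open>x - x b\<close> with the order \<open>1 - \<alpha> < \<gamma>\<close> and a constant weight; here the derivative is moreover bounded
  and continuous.

  It remains to identify the value. Replacing the continuous derivative of \<open>x - x b\<close> by the
  difference quotients of its primitive and using associativity of convolutions turns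
  minus the pairing of the two fractional derivatives into the limit of
  \<open>(1 / e) * \<integral> f r * (x (r + e) - x r) dr\<close>, with \<open>x\<close> extended by a constant beyond \<open>b\<close>
  (\<open>pairing_tendsto\<close>, \<open>convolve_difference\<close>). A Taylor expansion compares the integrand with
  \<open>y (r + e) - y r\<close>: the weighted estimate for \<open>\<sigma> \<circ> \<psi>\<close> bounds the error by an integrable function
  times \<open>e powr (\<gamma> * (1 + \<kappa> + \<eta>))\<close>, which is \<open>o(e)\<close> by the same inequality between the exponents.
  The remaining average of increments of \<open>y\<close> tends to \<open>y b - y 0 = y b\<close>.
\<close>

section \<open>Convolution with Riemann-Liouville kernels\<close>

text \<open>
  The fractional integral of order \<open>\<alpha>\<close> started at \<open>0\<close> is the convolution with this kernel, for
  functions that vanish on the negative half-line. The kernel of order \<open>1\<close> yields the primitive.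
\<close>
definition rl_kernel :: "real \<Rightarrow> real \<Rightarrow> real" where
  "rl_kernel \<alpha> v = (if 0 < v then v powr (\<alpha> - 1) / Gamma \<alpha> else 0)"

definition convolve :: "(real \<Rightarrow> real) \<Rightarrow> (real \<Rightarrow> real) \<Rightarrow> real \<Rightarrow> real" where
  "convolve f g t = (\<integral>s. f (t - s) * g s \<partial>lborel)"

lemma rl_kernel_measurable [measurable]: "rl_kernel \<alpha> \<in> borel_measurable borel"
  unfolding rl_kernel_def[abs_def] by measurable

lemma rl_kernel_nonneg: "0 < \<alpha> \<Longrightarrow> 0 \<le> rl_kernel \<alpha> v"
  by (auto simp: rl_kernel_def intro!: divide_nonneg_pos Gamma_real_pos)

lemma rl_kernel_1: "rl_kernel 1 v = (if 0 < v then 1 else 0)"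
  by (simp add: rl_kernel_def)

lemma convolve_measurable [measurable]:
  assumes [measurable]: "f \<in> borel_measurable borel" "g \<in> borel_measurable borel"
  shows "convolve f g \<in> borel_measurable borel"
  unfolding convolve_def[abs_def] by measurable

lemma integrable_lborel_pairI:
  fixes f :: "real \<Rightarrow> real \<Rightarrow> real"
  assumes [measurable]: "case_prod f \<in> borel_measurable (lborel \<Otimes>\<^sub>M lborel)"
    and fin: "(\<integral>\<^sup>+x. \<integral>\<^sup>+y. ennreal \<bar>f x y\<bar> \<partial>lborel \<partial>lborel) < \<infinity>"
  shows "integrable (lborel \<Otimes>\<^sub>M lborel) (case_prod f)"
proof (rule integrableI_bounded)
  have "(\<integral>\<^sup>+p. ennreal (norm (case_prod f p)) \<partial>(lborel \<Otimes>\<^sub>M lborel))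
      = (\<integral>\<^sup>+x. \<integral>\<^sup>+y. ennreal (norm (case_prod f (x, y))) \<partial>lborel \<partial>lborel)"
    by (rule lborel.nn_integral_fst[symmetric]) measurable
  then show "(\<integral>\<^sup>+p. ennreal (norm (case_prod f p)) \<partial>(lborel \<Otimes>\<^sub>M lborel)) < \<infinity>"
    using fin by simp
qed measurable

text \<open>
  Rescaling to the unit interval turns this into the Beta integral.
\<close>
lemma nn_integral_rl_kernel_convolve:
  assumes a: "0 < a" and b: "0 < b"
  shows "(\<integral>\<^sup>+s. ennreal (rl_kernel a (t - s) * rl_kernel b (s - r)) \<partial>lborel)
           = ennreal (rl_kernel (a + b) (t - r))"
proof (cases "r < t")
  case False
  then have zero: "rl_kernel a (t - s) * rl_kernel b (s - r) = 0" for s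
    by (auto simp: rl_kernel_def)
  have "rl_kernel (a + b) (t - r) = 0" using False by (simp add: rl_kernel_def)
  then show ?thesis unfolding zero by simp
next
  case True
  define d where "d = t - r"
  have d: "d > 0" using True by (simp add: d_def)
  define c where "c = d powr (a + b - 2) / (Gamma a * Gamma b)"
  have c: "c \<ge> 0" using a b by (auto simp: c_def intro!: divide_nonneg_pos mult_pos_pos Gamma_real_pos)
  have pt: "rl_kernel a (t - (r + d * v)) * rl_kernel b (r + d * v - r)
      = c * (v powr (b - 1) * (1 - v) powr (a - 1) * indicator {0..1} v)" for v
  proof -
    have e: "t - (r + d * v) = d * (1 - v)" by (simp add: d_def algebra_simps)
    consider "v \<le> 0" | "v \<ge> 1" | "0 < v" "v < 1" by linarith
    then show ?thesis
    proof cases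
      case 1
      then have "d * v \<le> 0" using d by (simp add: mult_nonneg_nonpos)
      with 1 show ?thesis by (cases "v = 0") (simp_all add: rl_kernel_def)
    next
      case 2
      then have "d * (1 - v) \<le> 0" using d by (simp add: mult_nonneg_nonpos)
      with 2 show ?thesis unfolding e by (cases "v = 1") (simp_all add: rl_kernel_def)
    next
      case 3
      then have "d * (1 - v) > 0" "d * v > 0" using d by simp_all
      moreover have "d powr (a + b - 2) = d powr (a - 1) * d powr (b - 1)"
        by (simp add: powr_add[symmetric])
      ultimately show ?thesis unfolding e using 3 d
        by (simp add: rl_kernel_def c_def powr_mult)
    qed
  qed
  have "(\<integral>\<^sup>+s. ennreal (rl_kernel a (t - s) * rl_kernel b (s - r)) \<partial>lborel)
      = ennreal d * (\<integral>\<^sup>+v. ennreal (rl_kernel a (t - (r + d * v)) * rl_kernel b (r + d * v - r)) \<partial>lborel)"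
    using nn_integral_real_affine[of "\<lambda>s. ennreal (rl_kernel a (t - s) * rl_kernel b (s - r))" d r] d
    by simp
  also have "\<dots> = ennreal d * (\<integral>\<^sup>+v. ennreal c * (ennreal (v powr (b - 1) * (1 - v) powr (a - 1)) * indicator {0..1} v) \<partial>lborel)"
    unfolding pt using c by (simp add: ennreal_mult' nn_integral_set_ennreal[symmetric] ennreal_indicator mult.assoc)
  also have "\<dots> = ennreal d * (ennreal c * (\<integral>\<^sup>+v. ennreal (v powr (b - 1) * (1 - v) powr (a - 1)) * indicator {0..1} v \<partial>lborel))"
    by (subst nn_integral_cmult) auto
  also have "(\<integral>\<^sup>+v. ennreal (v powr (b - 1) * (1 - v) powr (a - 1)) * indicator {0..1} v \<partial>lborel) = ennreal (Beta b a)"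
    by (rule nn_integral_has_integral_lebesgue'[OF _ has_integral_Beta_real[OF b a]]) auto
  also have "ennreal d * (ennreal c * ennreal (Beta b a)) = ennreal (d * c * Beta b a)"
    using d c by (simp add: ennreal_mult' mult.assoc)
  also have "d * c * Beta b a = rl_kernel (a + b) (t - r)"
  proof -
    have "d powr (a + b - 1) = d * d powr (a + b - 2)"
      using d powr_add[of d 1 "a + b - 2"] by simp
    moreover have "Gamma a > 0" "Gamma b > 0" using a b by (auto intro: Gamma_real_pos)
    ultimately show ?thesis using d True
      by (simp add: rl_kernel_def Beta_def c_def d_def[symmetric] add.commute field_simps)
  qed
  finally show ?thesis .
qed

text \<open>
  The restriction \<open>1 \<le> a + b\<close> makes the kernel of order \<open>a + b\<close> locally bounded. Fubini then applies
  at every \<open>t\<close>, and the law holds pointwise rather than almost everywhere.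
\<close>
lemma
  assumes a: "0 < a" and b: "0 < b" and ab: "1 \<le> a + b"
    and F: "integrable lborel F" and F0: "\<And>s. s < 0 \<Longrightarrow> F s = 0"
  shows rl_kernel_triple_integrable:
      "integrable (lborel \<Otimes>\<^sub>M lborel) (\<lambda>(s, r). rl_kernel a (t - s) * (rl_kernel b (s - r) * F r))"
    and rl_kernel_semigroup:
      "convolve (rl_kernel a) (convolve (rl_kernel b) F) t = convolve (rl_kernel (a + b)) F t"
proof -
  have [measurable]: "F \<in> borel_measurable borel" using F by auto
  \<comment> \<open>The values of the kernel of order \<open>a + b\<close> that meet the support of \<open>F\<close> are at most \<open>B\<close>.\<close>
  define B where "B = \<bar>t\<bar> powr (a + b - 1) / Gamma (a + b)"
  have B0: "B \<ge> 0" using a b by (auto simp: B_def intro!: divide_nonneg_nonneg)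
  have B: "rl_kernel (a + b) (t - r) * \<bar>F r\<bar> \<le> B * \<bar>F r\<bar>" for r
  proof (cases "0 \<le> r \<and> r < t")
    case True
    then have "(t - r) powr (a + b - 1) \<le> \<bar>t\<bar> powr (a + b - 1)"
      using ab by (intro powr_mono2) auto
    then show ?thesis using True a b
      by (auto simp: rl_kernel_def B_def intro!: mult_right_mono divide_right_mono)
  next
    case False
    then have "rl_kernel (a + b) (t - r) * \<bar>F r\<bar> = 0" using F0[of r] by (auto simp: rl_kernel_def)
    then show ?thesis using B0 by (metis abs_ge_zero mult_nonneg_nonneg)
  qed
  have "(\<integral>\<^sup>+s. \<integral>\<^sup>+r. ennreal \<bar>rl_kernel a (t - s) * (rl_kernel b (s - r) * F r)\<bar> \<partial>lborel \<partial>lborel)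
      = (\<integral>\<^sup>+r. \<integral>\<^sup>+s. ennreal \<bar>rl_kernel a (t - s) * (rl_kernel b (s - r) * F r)\<bar> \<partial>lborel \<partial>lborel)"
    by (rule lborel_pair.Fubini'[symmetric]) measurable
  also have "\<dots> = (\<integral>\<^sup>+r. \<integral>\<^sup>+s. ennreal (rl_kernel a (t - s) * rl_kernel b (s - r)) * ennreal \<bar>F r\<bar> \<partial>lborel \<partial>lborel)"
    using rl_kernel_nonneg[OF a] rl_kernel_nonneg[OF b]
    by (simp add: abs_mult ennreal_mult' mult.assoc)
  also have "\<dots> = (\<integral>\<^sup>+r. ennreal (rl_kernel (a + b) (t - r)) * ennreal \<bar>F r\<bar> \<partial>lborel)"
    by (subst nn_integral_multc) (auto simp: nn_integral_rl_kernel_convolve[OF a b])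
  also have "\<dots> \<le> (\<integral>\<^sup>+r. ennreal (B * \<bar>F r\<bar>) \<partial>lborel)"
    using B rl_kernel_nonneg[of "a + b"] a b
    by (intro nn_integral_mono) (simp add: ennreal_mult'[symmetric] ennreal_leI)
  also have "\<dots> = ennreal (\<integral>r. B * \<bar>F r\<bar> \<partial>lborel)"
    using B0 by (intro nn_integral_eq_integral integrable_mult_right integrable_abs F) auto
  also have "\<dots> < \<infinity>" by simp
  finally have fin: "(\<integral>\<^sup>+s. \<integral>\<^sup>+r. ennreal \<bar>rl_kernel a (t - s) * (rl_kernel b (s - r) * F r)\<bar> \<partial>lborel \<partial>lborel) < \<infinity>" .
  show int: "integrable (lborel \<Otimes>\<^sub>M lborel) (\<lambda>(s, r). rl_kernel a (t - s) * (rl_kernel b (s - r) * F r))"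
    by (rule integrable_lborel_pairI[OF _ fin]) measurable
  have ker: "(\<integral>s. rl_kernel a (t - s) * rl_kernel b (s - r) \<partial>lborel) = rl_kernel (a + b) (t - r)" for r
    using nn_integral_rl_kernel_convolve[OF a b, of t r] rl_kernel_nonneg[OF a] rl_kernel_nonneg[OF b]
      rl_kernel_nonneg[of "a + b"] a b
    by (subst integral_eq_nn_integral) auto
  have "convolve (rl_kernel a) (convolve (rl_kernel b) F) t
      = (\<integral>s. \<integral>r. rl_kernel a (t - s) * (rl_kernel b (s - r) * F r) \<partial>lborel \<partial>lborel)"
    by (simp add: convolve_def)
  also have "\<dots> = (\<integral>r. \<integral>s. rl_kernel a (t - s) * (rl_kernel b (s - r) * F r) \<partial>lborel \<partial>lborel)"
    by (rule lborel_pair.Fubini_integral[OF int, symmetric])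
  also have "\<dots> = convolve (rl_kernel (a + b)) F t"
    by (simp add: convolve_def mult.assoc[symmetric] ker)
  finally show "convolve (rl_kernel a) (convolve (rl_kernel b) F) t = convolve (rl_kernel (a + b)) F t" .
qed

text \<open>
  The positive and the negative part of \<open>u\<close> are densities of two finite measures that agree on
  all half-lines, hence are equal.
\<close>
lemma AE_eq_0_if_primitive_eq_0:
  assumes u: "integrable lborel u" and tot: "(\<integral>r. u r \<partial>lborel) = 0"
    and prim: "\<And>t. convolve (rl_kernel 1) u t = 0"
  shows "AE r in lborel. u r = 0"
proof -
  have [measurable]: "u \<in> borel_measurable borel" using u by auto
  have int: "integrable lborel (\<lambda>r. indicator A r * g r)"
    if "integrable lborel g" "A \<in> sets borel" for A :: "real set" and g :: "real \<Rightarrow> real"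
    using integrable_mult_indicator[of A lborel g] that by simp
  have tail: "(\<integral>r. indicator {x<..} r * u r \<partial>lborel) = 0" for x
  proof -
    have "(\<integral>r. indicator {..<x} r * u r \<partial>lborel) = 0"
      using prim[of x] unfolding convolve_def
      by (simp add: rl_kernel_1 indicator_def of_bool_def)
    moreover have "(\<integral>r. u r \<partial>lborel) = (\<integral>r. indicator {..<x} r * u r + indicator {x<..} r * u r \<partial>lborel)"
      using AE_lborel_singleton[of x]
      by (intro integral_cong_AE) (auto elim!: eventually_mono split: split_indicator)
    moreover have "\<dots> = (\<integral>r. indicator {..<x} r * u r \<partial>lborel) + (\<integral>r. indicator {x<..} r * u r \<partial>lborel)"
      by (rule Bochner_Integration.integral_add) (auto intro: int u)
    ultimately show ?thesis using tot by simp
  qed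
  let ?M = "density lborel (\<lambda>r. ennreal (u r))" and ?N = "density lborel (\<lambda>r. ennreal (- u r))"
  have em: "emeasure (density lborel (\<lambda>r. ennreal (v r))) {x<..} = ennreal (\<integral>r. indicator {x<..} r * max 0 (v r) \<partial>lborel)"
    if v: "integrable lborel v" for v :: "real \<Rightarrow> real" and x
  proof -
    have [measurable]: "v \<in> borel_measurable borel" using v by auto
    have "emeasure (density lborel (\<lambda>r. ennreal (v r))) {x<..} = (\<integral>\<^sup>+r. ennreal (v r) * indicator {x<..} r \<partial>lborel)"
      by (rule emeasure_density) auto
    also have "\<dots> = (\<integral>\<^sup>+r. ennreal (indicator {x<..} r * max 0 (v r)) \<partial>lborel)"
      by (intro nn_integral_cong) (auto split: split_indicator simp: max_def ennreal_neg)
    also have "\<dots> = ennreal (\<integral>r. indicator {x<..} r * max 0 (v r) \<partial>lborel)"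
      using v by (intro nn_integral_eq_integral int) auto
    finally show ?thesis .
  qed
  have "?M = ?N"
  proof (rule measure_eqI_lessThan)
    fix x
    show "emeasure ?M {x<..} < \<infinity>" using em[OF u] by simp
    have "(\<integral>r. indicator {x<..} r * max 0 (u r) \<partial>lborel) - (\<integral>r. indicator {x<..} r * max 0 (- u r) \<partial>lborel)
        = (\<integral>r. indicator {x<..} r * max 0 (u r) - indicator {x<..} r * max 0 (- u r) \<partial>lborel)"
      using u by (intro Bochner_Integration.integral_diff[symmetric] int) auto
    also have "\<dots> = (\<integral>r. indicator {x<..} r * u r \<partial>lborel)"
      by (intro Bochner_Integration.integral_cong) (auto split: split_indicator)
    finally show "emeasure ?M {x<..} = emeasure ?N {x<..}"
      using tail[of x] em[OF u] em[OF integrable_minus[OF u]] by simp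
  qed auto
  then have "AE r in lborel. ennreal (u r) = ennreal (- u r)"
    by (intro sigma_finite_measure.density_unique[OF sigma_finite_lborel]) auto
  then show ?thesis
  proof eventually_elim
    case (elim r)
    then show ?case
      by (cases "u r \<ge> 0") (auto simp: ennreal_neg ennreal_eq_0_iff eq_commute[of 0])
  qed
qed

section \<open>Fractional derivatives under a weighted Hoelder condition\<close>

lemma
  fixes a c :: real
  shows integrable_powr_from_0:
      "-1 < a \<Longrightarrow> 0 \<le> c \<Longrightarrow> integrable lborel (\<lambda>u. indicator {0..c} u * u powr a)"
    and nn_integral_powr_to_inf:
      "a < -1 \<Longrightarrow> 0 < c \<Longrightarrow> (\<integral>\<^sup>+u. ennreal (indicator {c..} u * u powr a) \<partial>lborel) = ennreal (- (c powr (a + 1)) / (a + 1))"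
    and integrable_powr_to_inf:
      "a < -1 \<Longrightarrow> 0 < c \<Longrightarrow> integrable lborel (\<lambda>u. indicator {c..} u * u powr a)"
    and integral_powr_to_inf:
      "a < -1 \<Longrightarrow> 0 < c \<Longrightarrow> (\<integral>u. indicator {c..} u * u powr a \<partial>lborel) = - (c powr (a + 1)) / (a + 1)"
proof -
  show "integrable lborel (\<lambda>u. indicator {0..c} u * u powr a)" if "-1 < a" "0 \<le> c"
  proof -
    have "(\<integral>\<^sup>+u. ennreal (indicator {0..c} u * u powr a) \<partial>lborel) = ennreal (c powr (a + 1) / (a + 1))"
      by (rule nn_integral_has_integral_lebesgue[OF _ has_integral_powr_from_0[OF that]]) auto
    then show ?thesis by (intro integrableI_nonneg) auto
  qed
  show nn: "(\<integral>\<^sup>+u. ennreal (indicator {c..} u * u powr a) \<partial>lborel) = ennreal (- (c powr (a + 1)) / (a + 1))"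
    if "a < -1" "0 < c"
    by (rule nn_integral_has_integral_lebesgue[OF _ has_integral_powr_to_inf[OF that]]) auto
  show "integrable lborel (\<lambda>u. indicator {c..} u * u powr a)" if "a < -1" "0 < c"
    using nn[OF that] by (intro integrableI_nonneg) auto
  show "(\<integral>u. indicator {c..} u * u powr a \<partial>lborel) = - (c powr (a + 1)) / (a + 1)" if "a < -1" "0 < c"
  proof -
    have "- (c powr (a + 1)) / (a + 1) \<ge> 0" using that by (simp add: divide_nonneg_neg)
    then show ?thesis using nn[OF that] by (subst integral_eq_nn_integral) auto
  qed
qed

lemma integrable_rl_kernel_mult:
  fixes F :: "real \<Rightarrow> real"
  assumes a: "0 < a" and [measurable]: "F \<in> borel_measurable borel"
    and B: "\<And>s. \<bar>F s\<bar> \<le> B" and neg: "\<And>s. s < 0 \<Longrightarrow> F s = 0"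
  shows "integrable lborel (\<lambda>s. rl_kernel a (c - s) * F s)"
proof -
  have g: "Gamma a > 0" using a by simp
  have "integrable lborel (\<lambda>u. indicator {0..\<bar>c\<bar>} u * u powr (a - 1))"
    using a by (intro integrable_powr_from_0) auto
  then have "integrable lborel (\<lambda>s. indicator {0..\<bar>c\<bar>} (c - s) * (c - s) powr (a - 1))"
    using lborel_integrable_real_affine[of "\<lambda>u. indicator {0..\<bar>c\<bar>} u * u powr (a - 1)" "-1" c] by simp
  then have "integrable lborel (\<lambda>s. (indicator {0..\<bar>c\<bar>} (c - s) * (c - s) powr (a - 1)) * (B / Gamma a))"
    by (rule integrable_mult_left)
  then show ?thesis
  proof (rule Bochner_Integration.integrable_bound)
    have "B \<ge> 0" using B[of 0] by linarith
    then have le: "\<bar>rl_kernel a (c - s) * F s\<bar> \<le> (indicator {0..\<bar>c\<bar>} (c - s) * (c - s) powr (a - 1)) * (B / Gamma a)" for s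
      using B[of s] neg[of s] g
      by (cases "s < 0"; cases "s < c")
         (auto simp: rl_kernel_def abs_mult field_simps intro!: mult_left_mono split: split_indicator)
    show "AE s in lborel. norm (rl_kernel a (c - s) * F s)
        \<le> norm ((indicator {0..\<bar>c\<bar>} (c - s) * (c - s) powr (a - 1)) * (B / Gamma a))"
      unfolding real_norm_def by (intro AE_I2 order_trans[OF le abs_ge_self])
  qed measurable
qed

text \<open>
  The truncated fractional derivative of a function on the whole line that vanishes on the negative
  half-line. The part of the integral over \<open>u \<ge> t\<close> produces the boundary term \<open>F t / t powr \<alpha>\<close> of the
  derivative on an interval starting at \<open>0\<close>, so that no case distinction on \<open>\<epsilon> \<le> t\<close> is needed; \<open>\<epsilon> = 0\<close>
  is the derivative itself.
\<close>
definition marchaud :: "real \<Rightarrow> real \<Rightarrow> (real \<Rightarrow> real) \<Rightarrow> real \<Rightarrow> real" where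
  "marchaud \<alpha> \<epsilon> F t = \<alpha> / Gamma (1 - \<alpha>) *
     (\<integral>u. indicator {\<epsilon><..} u * ((F t - F (t - u)) * u powr (-1 - \<alpha>)) \<partial>lborel)"

lemma marchaud_measurable [measurable]:
  assumes [measurable]: "F \<in> borel_measurable borel"
  shows "marchaud \<alpha> \<epsilon> F \<in> borel_measurable borel"
  unfolding marchaud_def[abs_def] by measurable

text \<open>
  A Hoelder condition of order \<open>\<beta> > \<alpha>\<close> whose constant may depend on the later of the two times, in an
  integrable way. A null set of later times is exempt: the intended weight is infinite at the zeros of
  the solution. With \<open>F 0 = 0\<close> the condition extends to earlier times below \<open>0\<close>, where \<open>F\<close> vanishes.
\<close>
locale weighted_holder =
  fixes b \<alpha> \<beta> B :: real and F m :: "real \<Rightarrow> real"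
  assumes b_pos: "0 < b" and \<alpha>_pos: "0 < \<alpha>" and \<alpha>_less_1: "\<alpha> < 1" and \<alpha>_less_\<beta>: "\<alpha> < \<beta>"
    and F_measurable [measurable]: "F \<in> borel_measurable borel"
    and F_bounded: "\<And>t. \<bar>F t\<bar> \<le> B"
    and F_supp: "\<And>t. t \<notin> {0<..b} \<Longrightarrow> F t = 0"
    and m_nonneg: "\<And>t. 0 \<le> m t"
    and m_integrable: "integrable lborel (\<lambda>t. indicator {0..b} t * m t)"
    and increment: "AE t in lborel. t \<in> {0..b} \<longrightarrow> (\<forall>s\<in>{0..t}. \<bar>F t - F s\<bar> \<le> m t * (t - s) powr \<beta>)"
begin

text \<open>
  The integrand of \<open>marchaud\<close> at \<open>t\<close> is dominated by \<open>m t\<close> times this function. The power of \<open>u\<close> is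
  capped at \<open>b\<close> because \<open>F\<close> vanishes on the negative half-line, which makes the tail integrable.
\<close>
definition weight :: "real \<Rightarrow> real" where
  "weight u = indicator {0<..} u * (min u b powr \<beta> * u powr (-1 - \<alpha>))"

definition D :: "real \<Rightarrow> real" where
  "D t = indicator {0..b} t * marchaud \<alpha> 0 F t"

lemma D_measurable [measurable]: "D \<in> borel_measurable borel"
  unfolding D_def[abs_def] by measurable

lemma weight_measurable [measurable]: "weight \<in> borel_measurable borel"
  unfolding weight_def[abs_def] by measurable

lemma weight_nonneg: "0 \<le> weight u"
  by (simp add: weight_def)

lemma weight_integrable: "integrable lborel weight"
proof (rule Bochner_Integration.integrable_bound)
  show "integrable lborel (\<lambda>u. indicator {0..b} u * u powr (\<beta> - 1 - \<alpha>) + b powr \<beta> * (indicator {b..} u * u powr (-1 - \<alpha>)))"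
    using b_pos \<alpha>_pos \<alpha>_less_\<beta>
    by (intro Bochner_Integration.integrable_add integrable_mult_right integrable_powr_from_0 integrable_powr_to_inf) auto
  have "norm (weight u) \<le> (indicator {0..b} u * u powr (\<beta> - 1 - \<alpha>) + b powr \<beta> * (indicator {b..} u * u powr (-1 - \<alpha>)))" for u
  proof -
    have "u powr (\<beta> - 1 - \<alpha>) = u powr \<beta> * u powr (-1 - \<alpha>)"
      by (simp add: algebra_simps flip: powr_add)
    then show ?thesis
      by (auto simp: weight_def min_def split: split_indicator)
  qed
  then show "AE u in lborel. norm (weight u) \<le> norm (indicator {0..b} u * u powr (\<beta> - 1 - \<alpha>) + b powr \<beta> * (indicator {b..} u * u powr (-1 - \<alpha>)))"
    by (intro AE_I2) (smt (verit) real_norm_def)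
qed measurable

definition regular_at :: "real \<Rightarrow> bool" where
  "regular_at t \<longleftrightarrow> t \<in> {0..b} \<longrightarrow> (\<forall>s\<in>{0..t}. \<bar>F t - F s\<bar> \<le> m t * (t - s) powr \<beta>)"

lemma AE_regular: "AE t in lborel. regular_at t"
  using increment by (simp add: regular_at_def)

lemma increment_le:
  assumes t: "regular_at t" "t \<in> {0..b}" and u: "0 < u"
  shows "\<bar>F t - F (t - u)\<bar> \<le> m t * min u b powr \<beta>"
proof (cases "u \<le> t")
  case True
  then have "\<bar>F t - F (t - u)\<bar> \<le> m t * (t - (t - u)) powr \<beta>"
    using t u unfolding regular_at_def by (intro bspec[where x="t - u"]) auto
  moreover have "min u b = u" using True t by auto
  ultimately show ?thesis by simp
next
  case False
  have "F (t - u) = F 0" using False F_supp[of 0] F_supp[of "t - u"] by simp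
  then have "\<bar>F t - F (t - u)\<bar> \<le> m t * t powr \<beta>"
    using t unfolding regular_at_def by (metis atLeastAtMost_iff diff_zero order_refl)
  also have "\<dots> \<le> m t * min u b powr \<beta>"
    using False t m_nonneg[of t] \<alpha>_pos \<alpha>_less_\<beta> by (intro mult_left_mono powr_mono2) auto
  finally show ?thesis .
qed

lemma integrand_le:
  assumes "regular_at t" "t \<in> {0..b}" "0 \<le> \<epsilon>"
  shows "\<bar>indicator {\<epsilon><..} u * ((F t - F (t - u)) * u powr (-1 - \<alpha>))\<bar> \<le> m t * weight u"
  using increment_le[OF assms(1,2), of u] assms(3) m_nonneg[of t] weight_nonneg[of u]
  by (auto simp: weight_def abs_mult mult.assoc[symmetric] intro!: mult_right_mono split: split_indicator)

lemma integrand_integrable: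
  assumes "regular_at t" "t \<in> {0..b}" "0 \<le> \<epsilon>"
  shows "integrable lborel (\<lambda>u. indicator {\<epsilon><..} u * ((F t - F (t - u)) * u powr (-1 - \<alpha>)))"
  by (rule Bochner_Integration.integrable_bound[OF integrable_mult_right[OF weight_integrable, of "m t"]])
     (use integrand_le[OF assms] m_nonneg[of t] weight_nonneg in \<open>auto simp: abs_mult intro!: AE_I2\<close>)

definition marchaud_bound :: real where
  "marchaud_bound = \<alpha> / Gamma (1 - \<alpha>) * (\<integral>u. weight u \<partial>lborel)"

lemma coeff_nonneg: "0 \<le> \<alpha> / Gamma (1 - \<alpha>)"
  using \<alpha>_pos \<alpha>_less_1 by simp

lemma abs_marchaud_le:
  assumes "regular_at t" "t \<in> {0..b}" "0 \<le> \<epsilon>"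
  shows "\<bar>marchaud \<alpha> \<epsilon> F t\<bar> \<le> marchaud_bound * m t"
proof -
  have "\<bar>\<integral>u. indicator {\<epsilon><..} u * ((F t - F (t - u)) * u powr (-1 - \<alpha>)) \<partial>lborel\<bar>
      \<le> (\<integral>u. m t * weight u \<partial>lborel)"
    using integrand_le[OF assms] weight_integrable
    by (intro order_trans[OF integral_abs_bound] integral_mono integrable_abs integrand_integrable[OF assms]) auto
  then have "\<alpha> / Gamma (1 - \<alpha>) * \<bar>\<integral>u. indicator {\<epsilon><..} u * ((F t - F (t - u)) * u powr (-1 - \<alpha>)) \<partial>lborel\<bar>
      \<le> \<alpha> / Gamma (1 - \<alpha>) * (\<integral>u. m t * weight u \<partial>lborel)"
    by (rule mult_left_mono[OF _ coeff_nonneg])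
  then show ?thesis
    unfolding marchaud_def marchaud_bound_def abs_mult abs_of_nonneg[OF coeff_nonneg]
    by (simp add: mult_ac)
qed

lemma marchaud_integrable:
  assumes "0 \<le> \<epsilon>"
  shows "integrable lborel (\<lambda>t. indicator {0..b} t * marchaud \<alpha> \<epsilon> F t)"
proof (rule Bochner_Integration.integrable_bound[OF integrable_mult_right[OF m_integrable, of marchaud_bound]])
  show "AE t in lborel. norm (indicator {0..b} t * marchaud \<alpha> \<epsilon> F t) \<le> norm (marchaud_bound * (indicator {0..b} t * m t))"
    using AE_regular
  proof eventually_elim
    case (elim t)
    then show ?case using abs_marchaud_le[OF elim _ assms]
      by (auto simp: split: split_indicator)
  qed
qed measurable

lemma D_integrable: "integrable lborel D"
  using marchaud_integrable[of 0] by (simp add: D_def[abs_def])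

lemma marchaud_tendsto:
  assumes t: "regular_at t" "t \<in> {0..b}" and S: "\<And>n. 0 < S n" "S \<longlonglongrightarrow> 0"
  shows "(\<lambda>n. marchaud \<alpha> (S n) F t) \<longlonglongrightarrow> marchaud \<alpha> 0 F t"
  unfolding marchaud_def
proof (intro tendsto_mult_left integral_dominated_convergence)
  show "integrable lborel (\<lambda>u. m t * weight u)" using weight_integrable by simp
  show "AE u in lborel. norm (indicator {S n<..} u * ((F t - F (t - u)) * u powr (-1 - \<alpha>))) \<le> m t * weight u" for n
    using integrand_le[OF t] S(1)[of n] by (auto intro!: AE_I2)
  show "AE u in lborel. (\<lambda>n. indicator {S n<..} u * ((F t - F (t - u)) * u powr (-1 - \<alpha>)))
      \<longlonglongrightarrow> indicator {0<..} u * ((F t - F (t - u)) * u powr (-1 - \<alpha>))"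
  proof (intro AE_I2 tendsto_mult_right tendsto_eventually)
    fix u
    show "\<forall>\<^sub>F n in sequentially. indicator {S n<..} u = (indicator {0<..} u :: real)"
    proof (cases "0 < u")
      case True
      then have "\<forall>\<^sub>F n in sequentially. S n < u" by (rule order_tendstoD(2)[OF S(2)])
      then show ?thesis by eventually_elim (use True in auto)
    next
      case False
      then show ?thesis using S(1) by (intro always_eventually) (auto simp: indicator_def dest: less_trans)
    qed
  qed
qed measurable

text \<open>
  Dominated convergence twice: in \<open>u\<close> for the pointwise limit, and in \<open>t\<close> with the majorant
  \<open>2 * marchaud_bound * m\<close>.
\<close>
lemma marchaud_L1_tendsto:
  "((\<lambda>\<epsilon>. \<integral>t. indicator {0..b} t * \<bar>marchaud \<alpha> \<epsilon> F t - marchaud \<alpha> 0 F t\<bar> \<partial>lborel) \<longlongrightarrow> 0) (at_right 0)"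
proof (rule tendsto_at_right_sequentially[of 0 1])
  fix S :: "nat \<Rightarrow> real"
  assume S: "\<And>n. 0 < S n" "S \<longlonglongrightarrow> 0"
  have "(\<lambda>n. \<integral>t. indicator {0..b} t * \<bar>marchaud \<alpha> (S n) F t - marchaud \<alpha> 0 F t\<bar> \<partial>lborel) \<longlonglongrightarrow> (\<integral>t. 0 \<partial>(lborel :: real measure))"
  proof (rule integral_dominated_convergence)
    show "integrable lborel (\<lambda>t. 2 * marchaud_bound * (indicator {0..b} t * m t))"
      using m_integrable by simp
    show "AE t in lborel. norm (indicator {0..b} t * \<bar>marchaud \<alpha> (S n) F t - marchaud \<alpha> 0 F t\<bar>)
        \<le> 2 * marchaud_bound * (indicator {0..b} t * m t)" for n
      using AE_regular
    proof eventually_elim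
      case (elim t)
      then show ?case using abs_marchaud_le[OF elim, of 0] abs_marchaud_le[OF elim, of "S n"] S(1)[of n]
        by (auto split: split_indicator)
    qed
    show "AE t in lborel. (\<lambda>n. indicator {0..b} t * \<bar>marchaud \<alpha> (S n) F t - marchaud \<alpha> 0 F t\<bar>) \<longlonglongrightarrow> 0"
      using AE_regular
    proof eventually_elim
      case (elim t)
      show ?case
      proof (cases "t \<in> {0..b}")
        case True
        from marchaud_tendsto[OF elim True S] show ?thesis
          by (intro tendsto_mult_right_zero tendsto_rabs_zero) (simp add: LIM_zero)
      qed simp
    qed
  qed measurable
  then show "(\<lambda>n. \<integral>t. indicator {0..b} t * \<bar>marchaud \<alpha> (S n) F t - marchaud \<alpha> 0 F t\<bar> \<partial>lborel) \<longlonglongrightarrow> 0"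
    by simp
qed simp

lemma F_integrable: "integrable lborel F"
proof (rule Bochner_Integration.integrable_bound)
  show "integrable lborel (\<lambda>t. B * indicator {0..b} t)"
    by (intro integrable_mult_right integrable_real_indicator) (auto simp: emeasure_lborel_Icc_eq)
  show "AE t in lborel. norm (F t) \<le> norm (B * indicator {0..b} t)"
    using F_bounded F_supp
    by (intro AE_I2) (auto split: split_indicator simp: order_trans[OF F_bounded abs_ge_self])
qed measurable

text \<open>
  Integrating the increments \<open>F s - F (s - u)\<close> over \<open>s < c\<close> leaves the integral of \<open>F\<close> over the window
  from \<open>c - u\<close> to \<open>c\<close>. Integrating this against \<open>u powr (-1 - \<alpha>)\<close> gives the value \<open>F s\<close> the
  total weight \<open>(c - s) powr (- \<alpha>) / \<alpha>\<close>, that is, the kernel of order \<open>1 - \<alpha>\<close>. Fubini is applicable to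
  both orders of integration without truncation: before the windows are formed by the weighted Hoelder
  condition, afterwards since \<open>F\<close> is bounded.
\<close>
lemma primitive_D:
  assumes c: "c \<le> b"
  shows "convolve (rl_kernel 1) D c = convolve (rl_kernel (1 - \<alpha>)) F c"
proof -
  let ?\<Phi> = "\<lambda>s u. indicator {0..<c} s * (indicator {0<..} u * ((F s - F (s - u)) * u powr (-1 - \<alpha>)))"
  let ?\<Psi> = "\<lambda>s u. F s * (indicator {..<c} s * (indicator {c - s..} u * u powr (-1 - \<alpha>)))"
  have neg: "F s = 0" if "s \<le> 0" for s using F_supp[of s] that by simp

  have "(\<integral>\<^sup>+s. \<integral>\<^sup>+u. ennreal \<bar>?\<Phi> s u\<bar> \<partial>lborel \<partial>lborel)
      \<le> (\<integral>\<^sup>+s. \<integral>\<^sup>+u. ennreal (indicator {0..b} s * m s) * ennreal (weight u) \<partial>lborel \<partial>lborel)"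
  proof (rule nn_integral_mono_AE, use AE_regular in eventually_elim, rule nn_integral_mono)
    fix s u assume s: "regular_at s"
    show "ennreal \<bar>?\<Phi> s u\<bar> \<le> ennreal (indicator {0..b} s * m s) * ennreal (weight u)"
    proof (cases "s \<in> {0..<c}")
      case True
      then have "s \<in> {0..b}" using c by auto
      from integrand_le[OF s this, of 0 u] True this show ?thesis
        using m_nonneg[of s] by (simp add: ennreal_mult'[symmetric] ennreal_leI)
    qed simp
  qed
  also have "\<dots> = (\<integral>\<^sup>+s. ennreal (indicator {0..b} s * m s) \<partial>lborel) * (\<integral>\<^sup>+u. ennreal (weight u) \<partial>lborel)"
  proof -
    have [measurable]: "(\<lambda>s. indicator {0..b} s * m s) \<in> borel_measurable borel" using m_integrable by auto
    show ?thesis by (simp add: nn_integral_cmult nn_integral_multc)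
  qed
  also have "\<dots> < \<infinity>"
    using m_integrable weight_integrable m_nonneg weight_nonneg
    by (subst (1 2) nn_integral_eq_integral) (auto simp: ennreal_mult_less_top)
  finally have int\<Phi>: "integrable (lborel \<Otimes>\<^sub>M lborel) (\<lambda>(s, u). ?\<Phi> s u)"
    by (intro integrable_lborel_pairI) auto

  have inner: "(\<integral>u. indicator {c - s..} u * u powr (-1 - \<alpha>) \<partial>lborel) = (c - s) powr (- \<alpha>) / \<alpha>" if "s < c" for s
    using integral_powr_to_inf[of "-1 - \<alpha>" "c - s"] that \<alpha>_pos by simp
  have nninner: "(\<integral>\<^sup>+u. ennreal (indicator {c - s..} u * u powr (-1 - \<alpha>)) \<partial>lborel) = ennreal ((c - s) powr (- \<alpha>) / \<alpha>)" if "s < c" for s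
    using nn_integral_powr_to_inf[of "-1 - \<alpha>" "c - s"] that \<alpha>_pos by simp
  have intK: "integrable lborel (\<lambda>s. rl_kernel (1 - \<alpha>) (c - s) * \<bar>F s\<bar>)"
    using \<alpha>_less_1 F_bounded neg by (intro integrable_rl_kernel_mult[where B=B]) auto
  have g: "Gamma (1 - \<alpha>) > 0" using \<alpha>_less_1 by simp
  have "(\<integral>\<^sup>+s. \<integral>\<^sup>+u. ennreal \<bar>?\<Psi> s u\<bar> \<partial>lborel \<partial>lborel)
      = (\<integral>\<^sup>+s. ennreal (Gamma (1 - \<alpha>) / \<alpha> * (rl_kernel (1 - \<alpha>) (c - s) * \<bar>F s\<bar>)) \<partial>lborel)"
  proof (rule nn_integral_cong)
    fix s
    show "(\<integral>\<^sup>+u. ennreal \<bar>?\<Psi> s u\<bar> \<partial>lborel) = ennreal (Gamma (1 - \<alpha>) / \<alpha> * (rl_kernel (1 - \<alpha>) (c - s) * \<bar>F s\<bar>))"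
    proof (cases "s < c")
      case True
      have "(\<integral>\<^sup>+u. ennreal \<bar>?\<Psi> s u\<bar> \<partial>lborel)
          = (\<integral>\<^sup>+u. ennreal \<bar>F s\<bar> * ennreal (indicator {c - s..} u * u powr (-1 - \<alpha>)) \<partial>lborel)"
        using True by (intro nn_integral_cong) (simp add: abs_mult ennreal_mult')
      also have "\<dots> = ennreal \<bar>F s\<bar> * ennreal ((c - s) powr (- \<alpha>) / \<alpha>)"
        by (subst nn_integral_cmult) (simp_all add: nninner[OF True])
      also have "\<dots> = ennreal (Gamma (1 - \<alpha>) / \<alpha> * (rl_kernel (1 - \<alpha>) (c - s) * \<bar>F s\<bar>))"
        using True g \<alpha>_pos by (simp add: ennreal_mult'[symmetric] rl_kernel_def mult_ac)
      finally show ?thesis .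
    qed (simp add: rl_kernel_def)
  qed
  also have "\<dots> < \<infinity>"
    using intK \<alpha>_pos \<alpha>_less_1 rl_kernel_nonneg[of "1 - \<alpha>"]
    by (subst nn_integral_eq_integral) auto
  finally have fin\<Psi>: "(\<integral>\<^sup>+s. \<integral>\<^sup>+u. ennreal \<bar>?\<Psi> s u\<bar> \<partial>lborel \<partial>lborel) < \<infinity>" .
  have "(\<lambda>(s, u). ?\<Psi> s u) = (\<lambda>(s, u). F s * (indicator {..<c} s * (indicator {c..} (s + u) * u powr (-1 - \<alpha>))))"
    by (auto simp: fun_eq_iff split: split_indicator)
  then have "(\<lambda>(s, u). ?\<Psi> s u) \<in> borel_measurable (lborel \<Otimes>\<^sub>M lborel)"
    by simp
  then have int\<Psi>: "integrable (lborel \<Otimes>\<^sub>M lborel) (\<lambda>(s, u). ?\<Psi> s u)"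
    using fin\<Psi> by (rule integrable_lborel_pairI)

  \<comment> \<open>The two integrands agree after integration in \<open>s\<close>, although they differ pointwise.\<close>
  have swap: "(\<integral>s. ?\<Phi> s u \<partial>lborel) = (\<integral>s. ?\<Psi> s u \<partial>lborel)" for u
  proof (cases "u > 0")
    case True
    have i: "integrable lborel (\<lambda>s. indicator {..<d} s * F s)" for d
      using integrable_mult_indicator[of "{..<d}" lborel F] F_integrable by simp
    have shift: "(\<integral>s. indicator {..<c - u} s * F s \<partial>lborel) = (\<integral>s. indicator {..<c} s * F (s - u) \<partial>lborel)"
      using lborel_integral_real_affine[of 1 "\<lambda>s. indicator {..<c - u} s * F s" "-u"]
      by (simp add: indicator_def)
    have i': "integrable lborel (\<lambda>s. indicator {..<c} s * F (s - u))"
      using lborel_integrable_real_affine[OF i[of "c - u"], of 1 "-u"] by (simp add: indicator_def)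
    have "(\<integral>s. ?\<Phi> s u \<partial>lborel) = (\<integral>s. u powr (-1 - \<alpha>) * (indicator {..<c} s * F s - indicator {..<c} s * F (s - u)) \<partial>lborel)"
      using neg True by (intro Bochner_Integration.integral_cong) (auto split: split_indicator)
    also have "\<dots> = u powr (-1 - \<alpha>) * ((\<integral>s. indicator {..<c} s * F s \<partial>lborel) - (\<integral>s. indicator {..<c - u} s * F s \<partial>lborel))"
      using i i' by (simp add: shift)
    also have "\<dots> = (\<integral>s. u powr (-1 - \<alpha>) * (indicator {..<c} s * F s - indicator {..<c - u} s * F s) \<partial>lborel)"
      using i by simp
    also have "\<dots> = (\<integral>s. ?\<Psi> s u \<partial>lborel)"
      using True by (intro Bochner_Integration.integral_cong) (auto split: split_indicator)
    finally show ?thesis .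
  next
    case False
    then show ?thesis
      by (intro Bochner_Integration.integral_cong) (auto split: split_indicator)
  qed

  have "convolve (rl_kernel 1) D c = (\<integral>s. \<alpha> / Gamma (1 - \<alpha>) * (\<integral>u. ?\<Phi> s u \<partial>lborel) \<partial>lborel)"
    unfolding convolve_def D_def marchaud_def using c
    by (intro Bochner_Integration.integral_cong) (auto simp: rl_kernel_1 split: split_indicator)
  also have "\<dots> = \<alpha> / Gamma (1 - \<alpha>) * (\<integral>s. \<integral>u. ?\<Phi> s u \<partial>lborel \<partial>lborel)"
    by simp
  also have "(\<integral>s. \<integral>u. ?\<Phi> s u \<partial>lborel \<partial>lborel) = (\<integral>u. \<integral>s. ?\<Phi> s u \<partial>lborel \<partial>lborel)"
    by (rule lborel_pair.Fubini_integral[OF int\<Phi>, symmetric])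
  also have "\<dots> = (\<integral>u. \<integral>s. ?\<Psi> s u \<partial>lborel \<partial>lborel)"
    by (simp only: swap)
  also have "\<dots> = (\<integral>s. \<integral>u. ?\<Psi> s u \<partial>lborel \<partial>lborel)"
    by (rule lborel_pair.Fubini_integral[OF int\<Psi>])
  also have "\<dots> = (\<integral>s. Gamma (1 - \<alpha>) / \<alpha> * (rl_kernel (1 - \<alpha>) (c - s) * F s) \<partial>lborel)"
    using g \<alpha>_pos by (intro Bochner_Integration.integral_cong) (auto simp: inner rl_kernel_def split: split_indicator)
  also have "\<dots> = Gamma (1 - \<alpha>) / \<alpha> * convolve (rl_kernel (1 - \<alpha>)) F c"
    by (simp add: convolve_def)
  also have "\<alpha> / Gamma (1 - \<alpha>) * (Gamma (1 - \<alpha>) / \<alpha> * convolve (rl_kernel (1 - \<alpha>)) F c) = convolve (rl_kernel (1 - \<alpha>)) F c"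
    using g \<alpha>_pos by simp
  finally show ?thesis .
qed

lemma D_supp: "t \<notin> {0..b} \<Longrightarrow> D t = 0"
  by (simp add: D_def)

text \<open>
  The primitive of the fractional integral of \<open>D\<close> is, by the semigroup law, the fractional integral
  of the primitive of \<open>D\<close>, hence that of the fractional integral of \<open>F\<close> of order \<open>1 - \<alpha>\<close>, hence the
  primitive of \<open>F\<close>. Both sides have the same primitive on \<open>[0, b]\<close>.
\<close>
lemma inversion: "AE t in lborel. t \<le> b \<longrightarrow> convolve (rl_kernel \<alpha>) D t = F t"
proof -
  let ?I = "convolve (rl_kernel \<alpha>) D"
  have Ineg: "?I t = 0" if "t \<le> 0" for t
  proof -
    have zero: "rl_kernel \<alpha> (t - s) * D s = 0" for s
      using that D_supp[of s] by (auto simp: rl_kernel_def)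
    show ?thesis unfolding convolve_def zero by simp
  qed
  define u where "u t = indicator {0..b} t * (?I t - F t)" for t
  have intI: "integrable lborel (\<lambda>s. rl_kernel 1 (c - s) * ?I s)" for c
    using lborel_pair.integrable_fst'[OF rl_kernel_triple_integrable[of 1 \<alpha> D c]] \<alpha>_pos D_integrable D_supp
    by (simp add: convolve_def)
  have intF: "integrable lborel (\<lambda>s. rl_kernel 1 (c - s) * F s)" for c
    using F_bounded F_supp by (intro integrable_rl_kernel_mult[where B=B]) auto
  have "integrable lborel (\<lambda>s. indicator {0..b} s *\<^sub>R (rl_kernel 1 (b + 1 - s) * ?I s - rl_kernel 1 (b + 1 - s) * F s))"
    by (intro integrable_mult_indicator Bochner_Integration.integrable_diff intI intF) auto
  also have "(\<lambda>s. indicator {0..b} s *\<^sub>R (rl_kernel 1 (b + 1 - s) * ?I s - rl_kernel 1 (b + 1 - s) * F s)) = u"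
    by (auto simp: fun_eq_iff u_def rl_kernel_1 split: split_indicator)
  finally have u: "integrable lborel u" .
  have low: "convolve (rl_kernel 1) u t = 0" if t: "t \<le> b" for t
  proof -
    have "convolve (rl_kernel 1) u t = (\<integral>s. rl_kernel 1 (t - s) * ?I s - rl_kernel 1 (t - s) * F s \<partial>lborel)"
      unfolding convolve_def[of _ u] u_def using t Ineg F_supp
      by (intro Bochner_Integration.integral_cong) (auto simp: rl_kernel_1 split: split_indicator)
    also have "\<dots> = convolve (rl_kernel 1) ?I t - convolve (rl_kernel 1) F t"
      by (simp add: intI intF convolve_def[of "rl_kernel 1"])
    also have "convolve (rl_kernel 1) ?I t = convolve (rl_kernel (1 + \<alpha>)) D t"
      using \<alpha>_pos D_integrable D_supp by (intro rl_kernel_semigroup) auto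
    also have "\<dots> = convolve (rl_kernel \<alpha>) (convolve (rl_kernel 1) D) t"
      using \<alpha>_pos D_integrable D_supp by (subst rl_kernel_semigroup) (auto simp: add.commute)
    also have "\<dots> = convolve (rl_kernel \<alpha>) (convolve (rl_kernel (1 - \<alpha>)) F) t"
      unfolding convolve_def[of "rl_kernel \<alpha>"]
    proof (rule Bochner_Integration.integral_cong[OF refl])
      fix s show "rl_kernel \<alpha> (t - s) * convolve (rl_kernel 1) D s = rl_kernel \<alpha> (t - s) * convolve (rl_kernel (1 - \<alpha>)) F s"
        using t primitive_D[of s] by (cases "s < t") (auto simp: rl_kernel_def)
    qed
    also have "\<dots> = convolve (rl_kernel 1) F t"
      using \<alpha>_pos \<alpha>_less_1 F_integrable F_supp by (subst rl_kernel_semigroup) auto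
    finally show ?thesis by simp
  qed
  have eq: "convolve (rl_kernel 1) u t = (\<integral>r. u r \<partial>lborel)" if "b \<le> t" for t
    unfolding convolve_def
  proof (rule integral_cong_AE)
    show "AE s in lborel. rl_kernel 1 (t - s) * u s = u s"
      using AE_lborel_singleton[of b]
      by eventually_elim (use that in \<open>auto simp: rl_kernel_1 u_def split: split_indicator\<close>)
  qed (use u in auto)
  have tot: "(\<integral>r. u r \<partial>lborel) = 0" using eq[of b] low[of b] by simp
  have "AE r in lborel. u r = 0"
    using u tot
  proof (rule AE_eq_0_if_primitive_eq_0)
    show "convolve (rl_kernel 1) u t = 0" for t
      using low[of t] eq[of t] tot by (cases "t \<le> b") auto
  qed
  then show ?thesis
  proof eventually_elim
    case (elim t)
    then show ?case using Ineg[of t] F_supp[of t]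
      by (cases "t \<ge> 0") (auto simp: u_def split: split_indicator_asm)
  qed
qed

end

section \<open>Pairing two derivatives of complementary orders\<close>

locale uniform_holder = weighted_holder b \<alpha> \<beta> B F "\<lambda>_. K" for b \<alpha> \<beta> B F K +
  assumes regular: "regular_at t"
begin

lemma abs_diff_le:
  assumes "t \<le> b" "0 \<le> v"
  shows "\<bar>F t - F (t - v)\<bar> \<le> K * v powr \<beta>"
proof (cases "0 \<le> t \<and> 0 < v")
  case True
  then have "\<bar>F t - F (t - v)\<bar> \<le> K * min v b powr \<beta>"
    using assms by (intro increment_le regular) auto
  also have "\<dots> \<le> K * v powr \<beta>"
    using True m_nonneg b_pos \<alpha>_pos \<alpha>_less_\<beta> by (intro mult_left_mono powr_mono2) auto
  finally show ?thesis .
next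
  case False
  then have "F t - F (t - v) = 0" using assms F_supp[of t] F_supp[of "t - v"] by auto
  then show ?thesis using m_nonneg by simp
qed

lemma F_left_continuous:
  assumes "t \<le> b" "\<And>n. 0 \<le> v n" "v \<longlonglongrightarrow> 0"
  shows "(\<lambda>n. F (t - v n)) \<longlonglongrightarrow> F t"
proof -
  have "(\<lambda>n. K * v n powr \<beta>) \<longlonglongrightarrow> K * 0"
    using assms \<alpha>_pos \<alpha>_less_\<beta>
    by (intro tendsto_intros tendsto_zero_powrI[where b=\<beta>]) auto
  then have "(\<lambda>n. F t - F (t - v n)) \<longlonglongrightarrow> 0"
    by (rule Lim_null_comparison[rotated, OF tendsto_cong_limit]) (simp_all add: abs_diff_le assms)
  from tendsto_diff[OF tendsto_const[of "F t"] this] show ?thesis by simp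
qed

lemma abs_D_le: "\<bar>D t\<bar> \<le> marchaud_bound * K"
proof -
  have "0 \<le> marchaud_bound * K"
    using abs_marchaud_le[OF regular, of 0 0] b_pos by (smt (verit) atLeastAtMost_iff)
  then show ?thesis
    using abs_marchaud_le[OF regular, of t 0] by (auto simp: D_def split: split_indicator)
qed

text \<open>
  With a constant weight the majorant of the integrand does not depend on \<open>t\<close>, and continuity of \<open>F\<close>
  carries over to \<open>D\<close>. Times below \<open>0\<close> are moved to \<open>0\<close> in the proof so that the majorant is valid
  for every member of the sequence.
\<close>
lemma D_left_continuous:
  assumes t: "0 < t" "t \<le> b" and v: "\<And>n. 0 \<le> v n" "v \<longlonglongrightarrow> 0"
  shows "(\<lambda>n. D (t - v n)) \<longlonglongrightarrow> D t"
proof -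
  have ev: "\<forall>\<^sub>F n in sequentially. v n < t" by (rule order_tendstoD(2)[OF v(2) t(1)])
  have "(\<lambda>n. marchaud \<alpha> 0 F (max 0 (t - v n))) \<longlonglongrightarrow> marchaud \<alpha> 0 F t"
    unfolding marchaud_def
  proof (intro tendsto_mult_left integral_dominated_convergence)
    show "integrable lborel (\<lambda>u. K * weight u)" using weight_integrable by simp
    show "AE u in lborel. norm (indicator {0<..} u * ((F (max 0 (t - v n)) - F (max 0 (t - v n) - u)) * u powr (-1 - \<alpha>))) \<le> K * weight u" for n
      using integrand_le[OF regular, of "max 0 (t - v n)" 0] t v(1)[of n] by (auto intro!: AE_I2)
    show "AE u in lborel. (\<lambda>n. indicator {0<..} u * ((F (max 0 (t - v n)) - F (max 0 (t - v n) - u)) * u powr (-1 - \<alpha>)))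
        \<longlonglongrightarrow> indicator {0<..} u * ((F t - F (t - u)) * u powr (-1 - \<alpha>))"
    proof (intro AE_I2)
      fix u
      show "(\<lambda>n. indicator {0<..} u * ((F (max 0 (t - v n)) - F (max 0 (t - v n) - u)) * u powr (-1 - \<alpha>)))
        \<longlonglongrightarrow> indicator {0<..} u * ((F t - F (t - u)) * u powr (-1 - \<alpha>))"
      proof (cases "0 < u")
        case True
        have "(\<lambda>n. F (t - v n)) \<longlonglongrightarrow> F t" "(\<lambda>n. F (t - u - v n)) \<longlonglongrightarrow> F (t - u)"
          using F_left_continuous[of _ v] t v True by auto
        then have "(\<lambda>n. indicator {0<..} u * ((F (t - v n) - F (t - u - v n)) * u powr (-1 - \<alpha>)))
            \<longlonglongrightarrow> indicator {0<..} u * ((F t - F (t - u)) * u powr (-1 - \<alpha>))"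
          by (intro tendsto_intros)
        then show ?thesis
        proof (rule Lim_transform_eventually)
          show "\<forall>\<^sub>F n in sequentially. indicator {0<..} u * ((F (t - v n) - F (t - u - v n)) * u powr (-1 - \<alpha>))
            = indicator {0<..} u * ((F (max 0 (t - v n)) - F (max 0 (t - v n) - u)) * u powr (-1 - \<alpha>))"
            using ev by eventually_elim (simp add: algebra_simps max_def)
        qed
      qed simp
    qed
  qed measurable
  then have "(\<lambda>n. D (t - v n)) \<longlonglongrightarrow> marchaud \<alpha> 0 F t"
  proof (rule Lim_transform_eventually)
    show "\<forall>\<^sub>F n in sequentially. marchaud \<alpha> 0 F (max 0 (t - v n)) = D (t - v n)"
      using ev
    proof eventually_elim
      case (elim n)
      then show ?case using t v(1)[of n] by (simp add: D_def)
    qed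
  qed
  then show ?thesis using t by (simp add: D_def)
qed

lemma difference_quotient_primitive:
  assumes \<epsilon>: "0 < \<epsilon>"
  shows "(convolve (rl_kernel 1) D t - convolve (rl_kernel 1) D (t - \<epsilon>)) / \<epsilon>
    = (\<integral>v. indicator {0<..1} v * D (t - \<epsilon> * v) \<partial>lborel)"
proof -
  have i: "integrable lborel (\<lambda>s. indicator {..<d} s * D s)" for d
    using integrable_mult_indicator[of "{..<d}" lborel D] D_integrable by simp
  have W: "convolve (rl_kernel 1) D d = (\<integral>s. indicator {..<d} s * D s \<partial>lborel)" for d
    unfolding convolve_def by (intro Bochner_Integration.integral_cong) (auto simp: rl_kernel_1 split: split_indicator)
  have "convolve (rl_kernel 1) D t - convolve (rl_kernel 1) D (t - \<epsilon>)
      = (\<integral>s. indicator {..<t} s * D s - indicator {..<t - \<epsilon>} s * D s \<partial>lborel)"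
    unfolding W using i by simp
  also have "\<dots> = (\<integral>s. indicator {t - \<epsilon>..<t} s * D s \<partial>lborel)"
    using \<epsilon> by (intro Bochner_Integration.integral_cong) (auto split: split_indicator)
  also have "\<dots> = \<epsilon> * (\<integral>v. indicator {t - \<epsilon>..<t} (t - \<epsilon> * v) * D (t - \<epsilon> * v) \<partial>lborel)"
    using lborel_integral_real_affine[of "-\<epsilon>" "\<lambda>s. indicator {t - \<epsilon>..<t} s * D s" t] \<epsilon> by simp
  also have "(\<integral>v. indicator {t - \<epsilon>..<t} (t - \<epsilon> * v) * D (t - \<epsilon> * v) \<partial>lborel)
      = (\<integral>v. indicator {0<..1} v * D (t - \<epsilon> * v) \<partial>lborel)"
    using \<epsilon> by (intro Bochner_Integration.integral_cong) (auto simp: zero_less_mult_iff split: split_indicator)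
  finally show ?thesis using \<epsilon> by simp
qed

lemma
  shows difference_quotient_bounded:
      "0 < \<epsilon> \<Longrightarrow> \<bar>(convolve (rl_kernel 1) D t - convolve (rl_kernel 1) D (t - \<epsilon>)) / \<epsilon>\<bar> \<le> marchaud_bound * K"
    and difference_quotient_tendsto:
      "0 < t \<Longrightarrow> t \<le> b \<Longrightarrow> (\<And>n. 0 < e n) \<Longrightarrow> e \<longlonglongrightarrow> 0 \<Longrightarrow>
        (\<lambda>n. (convolve (rl_kernel 1) D t - convolve (rl_kernel 1) D (t - e n)) / e n) \<longlonglongrightarrow> D t"
proof -
  have int: "integrable lborel (\<lambda>v. marchaud_bound * K * indicator {0<..1::real} v)"
    by (intro integrable_mult_right integrable_real_indicator) auto
  have le: "norm (indicator {0<..1::real} v * D s) \<le> marchaud_bound * K * indicator {0<..1} v" for v s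
    using abs_D_le[of s] by (auto split: split_indicator)
  show "\<bar>(convolve (rl_kernel 1) D t - convolve (rl_kernel 1) D (t - \<epsilon>)) / \<epsilon>\<bar> \<le> marchaud_bound * K" if "0 < \<epsilon>"
  proof -
    have "\<bar>\<integral>v. indicator {0<..1} v * D (t - \<epsilon> * v) \<partial>lborel\<bar> \<le> (\<integral>v. marchaud_bound * K * indicator {0<..1::real} v \<partial>lborel)"
      using le int
      by (intro order_trans[OF integral_abs_bound] integral_mono integrable_abs Bochner_Integration.integrable_bound[OF int])
        (auto intro!: AE_I2 intro: order_trans[OF _ abs_ge_self])
    then show ?thesis using that by (simp add: difference_quotient_primitive)
  qed
  show "(\<lambda>n. (convolve (rl_kernel 1) D t - convolve (rl_kernel 1) D (t - e n)) / e n) \<longlonglongrightarrow> D t"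
    if t: "0 < t" "t \<le> b" and e: "\<And>n. 0 < e n" "e \<longlonglongrightarrow> 0"
  proof -
    have "(\<lambda>n. \<integral>v. indicator {0<..1} v * D (t - e n * v) \<partial>lborel) \<longlonglongrightarrow> (\<integral>v. indicator {0<..1::real} v * D t \<partial>lborel)"
    proof (rule integral_dominated_convergence[OF _ _ int])
      show "AE v in lborel. norm (indicator {0<..1} v * D (t - e n * v)) \<le> marchaud_bound * K * indicator {0<..1} v" for n
        using le by auto
      show "AE v in lborel. (\<lambda>n. indicator {0<..1} v * D (t - e n * v)) \<longlonglongrightarrow> indicator {0<..1} v * D t"
      proof (intro AE_I2)
        fix v :: real
        show "(\<lambda>n. indicator {0<..1} v * D (t - e n * v)) \<longlonglongrightarrow> indicator {0<..1} v * D t"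
        proof (cases "0 < v")
          case True
          then have "(\<lambda>n. e n * v) \<longlonglongrightarrow> 0" "\<And>n. 0 \<le> e n * v"
            using e by (auto intro: tendsto_mult_left_zero simp: less_imp_le)
          then show ?thesis by (intro tendsto_mult_left D_left_continuous t)
        qed simp
      qed
    qed measurable
    then show ?thesis using e(1) by (simp add: difference_quotient_primitive)
  qed
qed

end

text \<open>
  The two factors of the fractional integral, the second one reflected to start at \<open>0\<close>.
\<close>
locale complementary_pair =
  F: weighted_holder b \<alpha> \<beta> B F m + G: uniform_holder b "1 - \<alpha>" \<gamma> B' G K
  for b \<alpha> \<beta> \<gamma> B B' K F G m
begin

text \<open>
  By \<open>primitive_D\<close>, the primitive of \<open>G.D\<close> is the fractional integral of \<open>G\<close> of order \<open>\<alpha>\<close>.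
  Associativity moves this fractional integral over to \<open>F.D\<close>, which it turns into \<open>F\<close>.
\<close>
lemma convolve_primitive_D:
  assumes c: "c \<le> b"
  shows "convolve (convolve (rl_kernel 1) G.D) F.D c = convolve G F c"
proof -
  let ?f = "\<lambda>s r. G (c - s) * (rl_kernel \<alpha> (s - r) * F.D r)"
  have triple: "integrable (lborel \<Otimes>\<^sub>M lborel) (\<lambda>(s, r). rl_kernel 1 (c - s) * (rl_kernel \<alpha> (s - r) * F.D r))"
    using F.\<alpha>_pos F.D_integrable F.D_supp by (intro rl_kernel_triple_integrable) auto
  have int: "integrable (lborel \<Otimes>\<^sub>M lborel) (\<lambda>(s, r). ?f s r)"
  proof (rule Bochner_Integration.integrable_bound[OF integrable_mult_right[OF triple, of B']])
    have "\<bar>?f s r\<bar> \<le> \<bar>B' * (rl_kernel 1 (c - s) * (rl_kernel \<alpha> (s - r) * F.D r))\<bar>" for s r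
      using G.F_supp[of "c - s"] order_trans[OF G.F_bounded[of "c - s"] abs_ge_self]
      by (cases "s < c") (auto simp: abs_mult rl_kernel_1 intro!: mult_right_mono)
    then show "AE p in lborel \<Otimes>\<^sub>M lborel. norm (case p of (s, r) \<Rightarrow> ?f s r)
        \<le> norm (B' * (case p of (s, r) \<Rightarrow> rl_kernel 1 (c - s) * (rl_kernel \<alpha> (s - r) * F.D r)))"
      by (intro AE_I2) auto
  qed measurable
  have W: "convolve (rl_kernel 1) G.D (c - r) = (\<integral>s. G (c - s) * rl_kernel \<alpha> (s - r) \<partial>lborel)" if "0 \<le> r" for r
  proof -
    have "convolve (rl_kernel 1) G.D (c - r) = (\<integral>s. rl_kernel \<alpha> (c - r - s) * G s \<partial>lborel)"
      using G.primitive_D[of "c - r"] that c by (simp add: convolve_def[of "rl_kernel \<alpha>"])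
    also have "\<dots> = (\<integral>s. G (c - s) * rl_kernel \<alpha> (s - r) \<partial>lborel)"
      using lborel_integral_real_affine[of "-1" "\<lambda>s. rl_kernel \<alpha> (c - r - s) * G s" c]
      by (simp add: mult.commute)
    finally show ?thesis .
  qed
  have "convolve (convolve (rl_kernel 1) G.D) F.D c = (\<integral>r. \<integral>s. ?f s r \<partial>lborel \<partial>lborel)"
    unfolding convolve_def[of _ F.D]
  proof (rule Bochner_Integration.integral_cong[OF refl])
    fix r show "convolve (rl_kernel 1) G.D (c - r) * F.D r = (\<integral>s. ?f s r \<partial>lborel)"
      using W[of r] F.D_supp[of r] by (cases "0 \<le> r") (simp_all add: mult.assoc[symmetric])
  qed
  also have "\<dots> = (\<integral>s. \<integral>r. ?f s r \<partial>lborel \<partial>lborel)"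
    by (rule lborel_pair.Fubini_integral[OF int])
  also have "\<dots> = (\<integral>s. G (c - s) * convolve (rl_kernel \<alpha>) F.D s \<partial>lborel)"
    by (simp add: convolve_def)
  also have "\<dots> = (\<integral>s. G (c - s) * F s \<partial>lborel)"
  proof (rule integral_cong_AE)
    show "AE s in lborel. G (c - s) * convolve (rl_kernel \<alpha>) F.D s = G (c - s) * F s"
      using F.inversion
    proof eventually_elim
      case (elim s)
      then show ?case using G.F_supp[of "c - s"] c by (cases "s \<le> b") auto
    qed
  qed measurable
  also have "\<dots> = convolve G F c" by (simp add: convolve_def)
  finally show ?thesis .
qed

lemma integrable_D_mult:
  assumes [measurable]: "g \<in> borel_measurable borel" and g: "\<And>r. \<bar>g r\<bar> \<le> C"
  shows "integrable lborel (\<lambda>r. g r * F.D r)"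
  by (rule Bochner_Integration.integrable_bound[OF integrable_mult_right[OF F.D_integrable, of C]])
     (use order_trans[OF g abs_ge_self] in \<open>auto simp: abs_mult intro!: AE_I2 mult_right_mono\<close>)

text \<open>
  Replacing \<open>G.D\<close> by difference quotients of its primitive is harmless in the limit, as these are
  bounded and converge pointwise, while \<open>F.D\<close> is only integrable. For the difference quotients the
  pairing is computed by \<open>convolve_primitive_D\<close> without any fractional derivative.
\<close>
theorem pairing_tendsto:
  assumes e: "\<And>n. 0 < e n" "e \<longlonglongrightarrow> 0"
  shows "(\<lambda>n. (convolve G F b - convolve G F (b - e n)) / e n) \<longlonglongrightarrow> (\<integral>r. F.D r * G.D (b - r) \<partial>lborel)"
proof -
  let ?W = "convolve (rl_kernel 1) G.D"
  let ?q = "\<lambda>n r. (?W (b - r) - ?W (b - r - e n)) / e n"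
  have bound: "\<bar>?W t\<bar> \<le> (\<integral>s. \<bar>G.D s\<bar> \<partial>lborel)" for t
    unfolding convolve_def
  proof (rule order_trans[OF integral_abs_bound])
    have "integrable lborel (\<lambda>s. rl_kernel 1 (t - s) * G.D s)"
      by (rule Bochner_Integration.integrable_bound[OF G.D_integrable]) (auto simp: rl_kernel_1)
    then show "(\<integral>s. \<bar>rl_kernel 1 (t - s) * G.D s\<bar> \<partial>lborel) \<le> (\<integral>s. \<bar>G.D s\<bar> \<partial>lborel)"
      using G.D_integrable by (intro integral_mono integrable_abs) (auto simp: rl_kernel_1)
  qed
  have i: "integrable lborel (\<lambda>r. ?W (c - r) * F.D r)" for c
    using bound by (intro integrable_D_mult) auto
  have "(\<lambda>n. \<integral>r. F.D r * ?q n r \<partial>lborel) \<longlonglongrightarrow> (\<integral>r. F.D r * G.D (b - r) \<partial>lborel)"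
  proof (rule integral_dominated_convergence)
    show "integrable lborel (\<lambda>r. \<bar>F.D r\<bar> * (G.marchaud_bound * K))"
      using F.D_integrable by simp
    show "AE r in lborel. norm (F.D r * ?q n r) \<le> \<bar>F.D r\<bar> * (G.marchaud_bound * K)" for n
      unfolding real_norm_def abs_mult[of "F.D _"]
      by (intro AE_I2 mult_left_mono G.difference_quotient_bounded e abs_ge_zero)
    show "AE r in lborel. (\<lambda>n. F.D r * ?q n r) \<longlonglongrightarrow> F.D r * G.D (b - r)"
      using AE_lborel_singleton[of b]
    proof eventually_elim
      case (elim r)
      show ?case
      proof (cases "r \<in> {0..b}")
        case True
        with elim show ?thesis
          by (intro tendsto_mult_left G.difference_quotient_tendsto e) auto
      qed (simp add: F.D_supp)
    qed
  qed measurable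
  moreover have "(\<integral>r. F.D r * ?q n r \<partial>lborel) = (convolve G F b - convolve G F (b - e n)) / e n" for n
  proof -
    have "(\<integral>r. F.D r * ?q n r \<partial>lborel) = (\<integral>r. (?W (b - r) * F.D r - ?W (b - e n - r) * F.D r) / e n \<partial>lborel)"
      by (intro Bochner_Integration.integral_cong) (auto simp: algebra_simps diff_divide_distrib)
    also have "\<dots> = (convolve ?W F.D b - convolve ?W F.D (b - e n)) / e n"
      using i by (simp add: convolve_def[of _ F.D])
    also have "\<dots> = (convolve G F b - convolve G F (b - e n)) / e n"
      using e(1)[of n] by (simp add: convolve_primitive_D)
    finally show ?thesis .
  qed
  ultimately show ?thesis by (simp only:)
qed

end

section \<open>Fractional derivatives and integrals on an interval\<close>

lemma interval_integral_lebesgue_eq_lborel: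
  fixes \<phi> :: "real \<Rightarrow> real"
  assumes [measurable]: "\<phi> \<in> borel_measurable borel"
  shows "(LINT r=p..q|lebesgue. \<phi> r) = (LBINT r=p..q. \<phi> r)"
  unfolding interval_lebesgue_integral_def set_lebesgue_integral_def
  by (simp add: integral_completion)

lemma interval_integral_lebesgue_reflect:
  fixes \<phi> :: "real \<Rightarrow> real" and b p q :: real
  shows "(LINT r=p..q|lebesgue. \<phi> r) = (LINT r=b - q..b - p|lebesgue. \<phi> (b - r))"
proof -
  have *: "(LINT r|lebesgue. indicator {x<..<y} r * \<phi> r) = (LINT r|lebesgue. indicator {b - y<..<b - x} r * \<phi> (b - r))" for x y
    using lebesgue_integral_real_affine[of "-1" "\<lambda>r. indicator {x<..<y} r * \<phi> r" b]
    by (simp add: indicator_def conj_commute less_diff_eq diff_less_eq add.commute)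
  show ?thesis
    unfolding interval_lebesgue_integral_def set_lebesgue_integral_def by (simp add: *[of p q] *[of q p])
qed

lemma frac_int_right_reflect:
  "frac_int_right \<alpha> b h t = frac_int_left \<alpha> 0 (\<lambda>r. h (b - r)) (b - t)"
  unfolding frac_int_right_def frac_int_left_def
  by (subst interval_integral_lebesgue_reflect[where b=b]) (simp add: algebra_simps zero_ereal_def)

lemma frac_deriv_right_trunc_reflect:
  "frac_deriv_right_trunc \<epsilon> \<alpha> 0 b g t = frac_deriv_left_trunc \<epsilon> \<alpha> 0 b (\<lambda>r. g (b - r)) (b - t)"
proof -
  have "indicator {0..b} (b - r) = (indicator {0..b} r :: real)" for r
    by (auto simp: indicator_def)
  then show ?thesis
    unfolding frac_deriv_right_trunc_def frac_deriv_left_trunc_def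
    by (subst interval_integral_lebesgue_reflect[where b=b]) (simp add: algebra_simps zero_ereal_def)
qed

lemma L1_limit_reflect:
  assumes "L1_limit 0 b \<Phi> h"
  shows "L1_limit 0 b (\<lambda>\<epsilon> t. \<Phi> \<epsilon> (b - t)) (\<lambda>t. h (b - t))"
proof -
  have ind: "indicator {0..b} (b - t) = (indicator {0..b} t :: real)" for t
    by (auto simp: indicator_def)
  have i: "set_integrable lebesgue {0..b} (\<lambda>t. \<phi> (b - t))" if "set_integrable lebesgue {0..b} \<phi>" for \<phi> :: "real \<Rightarrow> real"
    using lebesgue_integrable_real_affine_iff[of "-1" "\<lambda>t. indicator {0..b} t *\<^sub>R \<phi> t" b] that
    by (simp add: set_integrable_def ind)
  have l: "(LINT t:{0..b}|lebesgue. \<phi> (b - t)) = (LINT t:{0..b}|lebesgue. \<phi> t)" for \<phi> :: "real \<Rightarrow> real"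
    using lebesgue_integral_real_affine[of "-1" "\<lambda>t. indicator {0..b} t *\<^sub>R \<phi> t" b]
    by (simp add: set_lebesgue_integral_def ind)
  show ?thesis
    using assms i l[of "\<lambda>t. \<bar>\<Phi> _ t - h t\<bar>"] unfolding L1_limit_def by simp
qed

context weighted_holder
begin

lemma truncated_integrand_integrable:
  assumes "0 < \<epsilon>"
  shows "integrable lborel (\<lambda>u. indicator {\<epsilon><..} u * ((F t - F (t - u)) * u powr (-1 - \<alpha>)))"
proof (rule Bochner_Integration.integrable_bound)
  show "integrable lborel (\<lambda>u. 2 * B * (indicator {\<epsilon>..} u * u powr (-1 - \<alpha>)))"
    using assms \<alpha>_pos by (intro integrable_mult_right integrable_powr_to_inf) auto
  have "\<bar>F t - F (t - u)\<bar> \<le> \<bar>2 * B\<bar>" for u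
    using F_bounded[of t] F_bounded[of "t - u"] by linarith
  then show "AE u in lborel. norm (indicator {\<epsilon><..} u * ((F t - F (t - u)) * u powr (-1 - \<alpha>)))
      \<le> norm (2 * B * (indicator {\<epsilon>..} u * u powr (-1 - \<alpha>)))"
    unfolding real_norm_def abs_mult
    by (intro AE_I2) (auto split: split_indicator intro!: mult_right_mono simp: abs_mult)
qed measurable

text \<open>
  \<open>F\<close> vanishes on this range, and the integral is the boundary term of the derivative on \<open>[0, b]\<close>.
\<close>
lemma integral_before_0:
  assumes t: "0 < t"
  shows "(LBINT r=-\<infinity>..0. (F t - F r) / (t - r) powr (1 + \<alpha>)) = F t / t powr \<alpha> / \<alpha>"
proof -
  have "(LBINT r=-\<infinity>..0. (F t - F r) / (t - r) powr (1 + \<alpha>))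
      = (\<integral>r. indicator {..<0} r * ((F t - F r) / (t - r) powr (1 + \<alpha>)) \<partial>lborel)"
    by (simp add: interval_lebesgue_integral_def set_lebesgue_integral_def zero_ereal_def)
  also have "\<dots> = (\<integral>u. indicator {t<..} u * ((F t - F (t - u)) / u powr (1 + \<alpha>)) \<partial>lborel)"
    using lborel_integral_real_affine[of "-1" "\<lambda>r. indicator {..<0} r * ((F t - F r) / (t - r) powr (1 + \<alpha>))" t]
    by (simp add: indicator_def)
  also have "\<dots> = (\<integral>u. F t * (indicator {t..} u * u powr (-1 - \<alpha>)) \<partial>lborel)"
  proof (rule integral_cong_AE)
    show "AE u in lborel. indicator {t<..} u * ((F t - F (t - u)) / u powr (1 + \<alpha>)) = F t * (indicator {t..} u * u powr (-1 - \<alpha>))"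
      using AE_lborel_singleton[of t]
    proof eventually_elim
      case (elim u)
      have "u powr (-1 - \<alpha>) = 1 / u powr (1 + \<alpha>)" using powr_minus_divide[of u "1 + \<alpha>"] by simp
      then show ?case using elim F_supp[of "t - u"] by (auto split: split_indicator)
    qed
  qed measurable
  also have "\<dots> = F t * (t powr (- \<alpha>) / \<alpha>)"
    using integral_powr_to_inf[of "-1 - \<alpha>" t] t \<alpha>_pos by simp
  finally show ?thesis by (simp add: powr_minus_divide)
qed

lemma interval_integral_eq_truncated:
  assumes "0 < \<epsilon>"
  shows "(LBINT r=-\<infinity>..ereal (t - \<epsilon>). (F t - F r) / (t - r) powr (1 + \<alpha>))
      = (\<integral>u. indicator {\<epsilon><..} u * ((F t - F (t - u)) * u powr (-1 - \<alpha>)) \<partial>lborel)"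
    and "interval_lebesgue_integrable lborel (-\<infinity>) (ereal (t - \<epsilon>)) (\<lambda>r. (F t - F r) / (t - r) powr (1 + \<alpha>))"
proof -
  have p: "x / u powr (1 + \<alpha>) = x * u powr (-1 - \<alpha>)" for x u :: real
    using powr_minus_divide[of u "1 + \<alpha>"] by simp
  have e: "indicator {..<t - \<epsilon>} (t - u) * ((F t - F (t - u)) / (t - (t - u)) powr (1 + \<alpha>))
      = indicator {\<epsilon><..} u * ((F t - F (t - u)) * u powr (-1 - \<alpha>))" for u
    by (simp add: p indicator_def)
  show "(LBINT r=-\<infinity>..ereal (t - \<epsilon>). (F t - F r) / (t - r) powr (1 + \<alpha>))
      = (\<integral>u. indicator {\<epsilon><..} u * ((F t - F (t - u)) * u powr (-1 - \<alpha>)) \<partial>lborel)"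
    using lborel_integral_real_affine[of "-1" "\<lambda>r. indicator {..<t - \<epsilon>} r * ((F t - F r) / (t - r) powr (1 + \<alpha>))" t] e
    by (simp add: interval_lebesgue_integral_def set_lebesgue_integral_def)
  show "interval_lebesgue_integrable lborel (-\<infinity>) (ereal (t - \<epsilon>)) (\<lambda>r. (F t - F r) / (t - r) powr (1 + \<alpha>))"
    using lborel_integrable_real_affine_iff[of "-1" "\<lambda>r. indicator {..<t - \<epsilon>} r * ((F t - F r) / (t - r) powr (1 + \<alpha>))" t] e
      truncated_integrand_integrable[OF assms, of t]
    by (simp add: interval_lebesgue_integrable_def set_integrable_def)
qed

text \<open>
  Split the integral over \<open>r < t - \<epsilon>\<close> at \<open>0\<close>. The time \<open>t = 0\<close> has to be excluded, as the boundary
  term divides by \<open>0\<close> there.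
\<close>
lemma frac_deriv_left_trunc_eq_marchaud:
  assumes f: "\<And>t. t \<in> {0..b} \<Longrightarrow> f t = F t" and t: "t \<in> {0<..b}" and \<epsilon>: "0 < \<epsilon>"
  shows "frac_deriv_left_trunc \<epsilon> \<alpha> 0 b f t = marchaud \<alpha> \<epsilon> F t"
proof -
  let ?\<phi> = "\<lambda>r. (F t - F r) / (t - r) powr (1 + \<alpha>)"
  have ext: "indicator {0..b} r * f r = F r" for r
    using f[of r] F_supp[of r] by (cases "r \<in> {0..b}") auto
  have "interval_lebesgue_integrable lborel (-\<infinity>) (ereal (t - min \<epsilon> t)) ?\<phi>"
    using t \<epsilon> by (intro interval_integral_eq_truncated(2)) auto
  \<comment> \<open>For \<open>t < \<epsilon>\<close> the integral from \<open>0\<close> to \<open>t - \<epsilon>\<close> runs backwards, so the integrand must be integrable up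
     to the larger of the two end points.\<close>
  moreover have "min (- \<infinity>) (min 0 (ereal (t - \<epsilon>))) = - \<infinity>" "max (- \<infinity>) (max 0 (ereal (t - \<epsilon>))) = ereal (t - min \<epsilon> t)"
    by (auto simp: max_def min_def zero_ereal_def)
  ultimately have "(LBINT r=-\<infinity>..0. ?\<phi> r) + (LBINT r=0..ereal (t - \<epsilon>). ?\<phi> r) = (LBINT r=-\<infinity>..ereal (t - \<epsilon>). ?\<phi> r)"
    by (intro interval_integral_sum) simp
  then have "marchaud \<alpha> \<epsilon> F t = \<alpha> / Gamma (1 - \<alpha>) * (F t / t powr \<alpha> / \<alpha> + (LBINT r=0..ereal (t - \<epsilon>). ?\<phi> r))"
    using t \<epsilon> by (simp add: marchaud_def interval_integral_eq_truncated integral_before_0)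
  also have "\<dots> = 1 / Gamma (1 - \<alpha>) * (F t / t powr \<alpha> + \<alpha> * (LINT r=0..ereal (t - \<epsilon>)|lebesgue. ?\<phi> r))"
    using \<alpha>_pos by (subst interval_integral_lebesgue_eq_lborel) (auto simp: field_simps)
  also have "\<dots> = frac_deriv_left_trunc \<epsilon> \<alpha> 0 b f t"
    using t f[of t] by (simp add: frac_deriv_left_trunc_def ext zero_ereal_def)
  finally show ?thesis ..
qed

lemma set_integrable_lebesgue_D: "set_integrable lebesgue {0..b} D" "set_integrable lebesgue {0..b} (\<lambda>t. D (b - t))"
proof -
  have [measurable]: "D \<in> borel_measurable borel" by measurable
  have "integrable lborel (\<lambda>t. indicator {0..b} t *\<^sub>R D t)"
    by (intro integrable_mult_indicator D_integrable) auto
  then show "set_integrable lebesgue {0..b} D" unfolding set_integrable_def by (simp add: integrable_completion)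
  have "integrable lborel (\<lambda>t. D (b - t))"
    using lborel_integrable_real_affine[OF D_integrable, of "-1" b] by simp
  then have "integrable lborel (\<lambda>t. indicator {0..b} t *\<^sub>R D (b - t))"
    by (intro integrable_mult_indicator) auto
  then show "set_integrable lebesgue {0..b} (\<lambda>t. D (b - t))" unfolding set_integrable_def by (simp add: integrable_completion)
qed

lemma has_frac_deriv_left:
  assumes f: "\<And>t. t \<in> {0..b} \<Longrightarrow> f t = F t"
  shows "has_frac_deriv_left \<alpha> 0 b f D"
proof -
  let ?g = "\<lambda>\<epsilon> t. frac_deriv_left_trunc \<epsilon> \<alpha> 0 b f t"
  \<comment> \<open>The discrepancy at the single point \<open>0\<close>.\<close>
  let ?c = "\<lambda>\<epsilon>. ?g \<epsilon> 0 - marchaud \<alpha> \<epsilon> F 0"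
  have eq: "indicator {0..b} t * ?g \<epsilon> t = indicator {0..b} t * marchaud \<alpha> \<epsilon> F t + ?c \<epsilon> * indicator {0} t" if "0 < \<epsilon>" for \<epsilon> t
    using frac_deriv_left_trunc_eq_marchaud[OF f _ that, of t] b_pos by (cases "t = 0") (auto split: split_indicator)
  have int: "integrable lborel (\<lambda>t. indicator {0..b} t * marchaud \<alpha> \<epsilon> F t + ?c \<epsilon> * indicator {0} t)" if "0 < \<epsilon>" for \<epsilon>
    using that by (intro Bochner_Integration.integrable_add marchaud_integrable integrable_mult_right integrable_real_indicator) auto
  have "set_integrable lebesgue {0..b} (?g \<epsilon>)" if "0 < \<epsilon>" for \<epsilon>
    unfolding set_integrable_def using int[OF that]
    by (simp add: eq[OF that] integrable_completion)
  moreover have "(LINT t:{0..b}|lebesgue. \<bar>?g \<epsilon> t - D t\<bar>)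
      = (\<integral>t. indicator {0..b} t * \<bar>marchaud \<alpha> \<epsilon> F t - marchaud \<alpha> 0 F t\<bar> \<partial>lborel)" if "0 < \<epsilon>" for \<epsilon>
  proof -
    have "(LINT t:{0..b}|lebesgue. \<bar>?g \<epsilon> t - D t\<bar>)
        = (\<integral>t. \<bar>indicator {0..b} t * ?g \<epsilon> t - indicator {0..b} t * marchaud \<alpha> 0 F t\<bar> \<partial>lebesgue)"
      unfolding set_lebesgue_integral_def D_def
      by (intro Bochner_Integration.integral_cong) (auto split: split_indicator)
    also have "\<dots> = (\<integral>t. \<bar>indicator {0..b} t * marchaud \<alpha> \<epsilon> F t + ?c \<epsilon> * indicator {0} t - indicator {0..b} t * marchaud \<alpha> 0 F t\<bar> \<partial>lborel)"
      unfolding eq[OF that] by (rule integral_completion) measurable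
    also have "\<dots> = (\<integral>t. indicator {0..b} t * \<bar>marchaud \<alpha> \<epsilon> F t - marchaud \<alpha> 0 F t\<bar> \<partial>lborel)"
    proof (rule integral_cong_AE)
      show "AE t in lborel. \<bar>indicator {0..b} t * marchaud \<alpha> \<epsilon> F t + ?c \<epsilon> * indicator {0} t - indicator {0..b} t * marchaud \<alpha> 0 F t\<bar>
          = indicator {0..b} t * \<bar>marchaud \<alpha> \<epsilon> F t - marchaud \<alpha> 0 F t\<bar>"
        using AE_lborel_singleton[of 0] by eventually_elim (auto split: split_indicator)
    qed measurable
    finally show ?thesis .
  qed
  then have "((\<lambda>\<epsilon>. LINT t:{0..b}|lebesgue. \<bar>?g \<epsilon> t - D t\<bar>) \<longlongrightarrow> 0) (at_right 0)"
    by (intro tendsto_cong[THEN iffD2, OF _ marchaud_L1_tendsto] eventually_at_right_less[THEN eventually_mono]) auto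
  ultimately show ?thesis
    unfolding has_frac_deriv_left_def L1_limit_def using set_integrable_lebesgue_D by blast
qed

lemma frac_int_left_D:
  assumes "0 \<le> t"
  shows "frac_int_left \<alpha> 0 D t = convolve (rl_kernel \<alpha>) D t"
proof -
  have "indicator {0<..} u * ((F 0 - F (0 - u)) * u powr (-1 - \<alpha>)) = 0" for u
    using F_supp[of 0] F_supp[of "0 - u"] by (auto split: split_indicator)
  then have D0: "D 0 = 0" unfolding D_def marchaud_def by (simp only:) simp
  have "frac_int_left \<alpha> 0 D t = 1 / Gamma \<alpha> * (\<integral>r. indicator {0<..<t} r * ((t - r) powr (\<alpha> - 1) * D r) \<partial>lborel)"
    unfolding frac_int_left_def using assms
    by (subst interval_integral_lebesgue_eq_lborel)
       (auto simp: interval_lebesgue_integral_def set_lebesgue_integral_def zero_ereal_def)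
  also have "\<dots> = (\<integral>r. 1 / Gamma \<alpha> * (indicator {0<..<t} r * ((t - r) powr (\<alpha> - 1) * D r)) \<partial>lborel)"
    by simp
  also have "\<dots> = convolve (rl_kernel \<alpha>) D t"
    unfolding convolve_def using D0 D_supp
    by (intro Bochner_Integration.integral_cong) (auto simp: rl_kernel_def not_less le_less split: split_indicator)
  finally show ?thesis .
qed

lemma mem_frac_image_left:
  assumes f: "\<And>t. t \<in> {0..b} \<Longrightarrow> f t = F t"
  shows "f \<in> frac_image_left \<alpha> 0 b"
proof -
  have "AE t in lborel. t \<in> {0..b} \<longrightarrow> f t = frac_int_left \<alpha> 0 D t"
    using inversion by eventually_elim (auto simp: f frac_int_left_D)
  then show ?thesis
    unfolding frac_image_left_def using set_integrable_lebesgue_D AE_completion by blast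
qed

lemma has_frac_deriv_right:
  assumes g: "\<And>t. t \<in> {0..b} \<Longrightarrow> g t = F (b - t)"
  shows "has_frac_deriv_right \<alpha> 0 b g (\<lambda>t. D (b - t))"
  using L1_limit_reflect[OF has_frac_deriv_left[unfolded has_frac_deriv_left_def, of "\<lambda>t. g (b - t)"]] g
  unfolding has_frac_deriv_right_def frac_deriv_right_trunc_reflect by simp

lemma mem_frac_image_right:
  assumes g: "\<And>t. t \<in> {0..b} \<Longrightarrow> g t = F (b - t)"
  shows "g \<in> frac_image_right \<alpha> 0 b"
proof -
  have "AE t in lborel. b + (-1) * t \<le> b \<longrightarrow> convolve (rl_kernel \<alpha>) D (b + (-1) * t) = F (b + (-1) * t)"
    by (rule AE_borel_affine[OF _ _ inversion]) auto
  then have "AE t in lborel. t \<in> {0..b} \<longrightarrow> g t = frac_int_right \<alpha> b (\<lambda>t. D (b - t)) t"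
    by eventually_elim (auto simp: g frac_int_right_reflect frac_int_left_D)
  then show ?thesis
    unfolding frac_image_right_def using set_integrable_lebesgue_D AE_completion by blast
qed

end

section \<open>The inverse of phi\<close>

text \<open>
  Let \<open>x \<ge> y\<close> be the two absolute values and \<open>s = y / x\<close>. Then
  \<open>1 - s powr \<kappa> \<le> 1 - s \<le> (1 - s) powr (\<kappa> + \<eta>)\<close> since both exponents are at most \<open>1\<close>; multiplying by
  \<open>x powr \<kappa>\<close> gives the bound with \<open>x powr \<eta>\<close> in the denominator, which is at least \<open>\<bar>q\<bar> powr \<eta>\<close>.
\<close>
lemma abs_powr_diff_le:
  fixes p q \<kappa> \<eta> :: real
  assumes \<kappa>: "0 < \<kappa>" "\<kappa> < 1" and \<eta>: "0 < \<eta>" "\<eta> < 1 - \<kappa>" and q: "q \<noteq> 0"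
  shows "\<bar>\<bar>p\<bar> powr \<kappa> - \<bar>q\<bar> powr \<kappa>\<bar> \<le> \<bar>p - q\<bar> powr (\<kappa> + \<eta>) / \<bar>q\<bar> powr \<eta>"
proof -
  have main: "x powr \<kappa> - y powr \<kappa> \<le> (x - y) powr (\<kappa> + \<eta>) / x powr \<eta>" if "0 \<le> y" "y \<le> x" "0 < x" for x y :: real
  proof -
    define s where "s = y / x"
    have s: "0 \<le> s" "s \<le> 1" and y: "y = x * s" using that by (auto simp: s_def)
    have "s powr 1 \<le> s powr \<kappa>" using s \<kappa> by (intro powr_mono') auto
    moreover have "(1 - s) powr 1 \<le> (1 - s) powr (\<kappa> + \<eta>)" using s \<kappa> \<eta> by (intro powr_mono') auto
    ultimately have "1 - s powr \<kappa> \<le> (1 - s) powr (\<kappa> + \<eta>)" using s by simp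
    then have "x powr \<kappa> * (1 - s powr \<kappa>) \<le> x powr \<kappa> * (1 - s) powr (\<kappa> + \<eta>)"
      by (intro mult_left_mono) auto
    moreover have "x powr \<kappa> * (1 - s powr \<kappa>) = x powr \<kappa> - y powr \<kappa>"
      using that s by (simp add: y powr_mult algebra_simps)
    moreover have "(x - y) powr (\<kappa> + \<eta>) = x powr (\<kappa> + \<eta>) * (1 - s) powr (\<kappa> + \<eta>)"
    proof -
      have "x - y = x * (1 - s)" by (simp add: y algebra_simps)
      then show ?thesis using that s by (simp add: powr_mult)
    qed
    moreover have "x powr (\<kappa> + \<eta>) = x powr \<kappa> * x powr \<eta>" by (rule powr_add)
    ultimately show ?thesis using that by simp
  qed
  define x where "x = max \<bar>p\<bar> \<bar>q\<bar>"
  define y where "y = min \<bar>p\<bar> \<bar>q\<bar>"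
  have "\<bar>\<bar>p\<bar> powr \<kappa> - \<bar>q\<bar> powr \<kappa>\<bar> = x powr \<kappa> - y powr \<kappa>"
    using \<kappa> powr_mono2[of \<kappa> "\<bar>p\<bar>" "\<bar>q\<bar>"] powr_mono2[of \<kappa> "\<bar>q\<bar>" "\<bar>p\<bar>"]
    by (auto simp: x_def y_def max_def min_def)
  also have "\<dots> \<le> (x - y) powr (\<kappa> + \<eta>) / x powr \<eta>"
    using q by (intro main) (auto simp: x_def y_def)
  also have "\<dots> \<le> \<bar>p - q\<bar> powr (\<kappa> + \<eta>) / \<bar>q\<bar> powr \<eta>"
    using q \<kappa> \<eta> by (intro frac_le powr_mono2) (auto simp: x_def y_def max_def min_def)
  finally show ?thesis .
qed

locale power_coefficient =
  fixes \<sigma> :: "real \<Rightarrow> real" and \<kappa> C :: real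
  assumes \<kappa>: "0 < \<kappa>" "\<kappa> < 1"
    and \<sigma>_0: "\<sigma> 0 = 0"
    and \<sigma>_diff: "\<And>p q. \<bar>\<sigma> p - \<sigma> q\<bar> \<le> C * \<bar>\<bar>p\<bar> powr \<kappa> - \<bar>q\<bar> powr \<kappa>\<bar>"
    and \<sigma>_mono: "mono_on {0..} \<sigma>"
    and recip: "\<forall>K. compact K \<and> 0 \<in> interior K \<longrightarrow> reciprocal_in_L1 K \<sigma>"
begin

text \<open>
  The increment condition compares \<open>\<sigma>\<close> at \<open>p\<close> and \<open>-p\<close>, so it forces \<open>\<sigma>\<close> to be even.
\<close>
lemma \<sigma>_minus: "\<sigma> (- p) = \<sigma> p"
  using \<sigma>_diff[of "-p" p] by simp

lemma \<sigma>_nonneg: "0 \<le> \<sigma> p"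
proof -
  have "\<sigma> 0 \<le> \<sigma> \<bar>p\<bar>" by (rule mono_onD[OF \<sigma>_mono]) auto
  then show ?thesis using \<sigma>_0 \<sigma>_minus[of p] by (cases "0 \<le> p") auto
qed

lemma \<sigma>_le: "\<sigma> p \<le> C * \<bar>p\<bar> powr \<kappa>"
  using \<sigma>_diff[of p 0] \<sigma>_0 by simp

lemma recip_Icc: "0 < R \<Longrightarrow> reciprocal_in_L1 {-R..R} \<sigma>"
  using recip[rule_format, of "{-R..R}"] by simp

text \<open>
  A zero at \<open>p > 0\<close> would by monotonicity make \<open>\<sigma>\<close> vanish on \<open>[0, p]\<close>, contradicting
  that the zeros of \<open>\<sigma>\<close> form a null set.
\<close>
lemma \<sigma>_pos: "p \<noteq> 0 \<Longrightarrow> 0 < \<sigma> p"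
proof -
  have pos: "0 < \<sigma> p" if p: "0 < p" for p
  proof (rule ccontr)
    assume "\<not> 0 < \<sigma> p"
    then have z: "\<sigma> p = 0" using \<sigma>_nonneg[of p] by simp
    have zero: "\<sigma> s = 0" if "s \<in> {0..p}" for s
      using that z mono_onD[OF \<sigma>_mono, of s p] \<sigma>_nonneg[of s] by auto
    have "AE s in lborel. s \<in> {-p..p} \<longrightarrow> \<sigma> s \<noteq> 0"
      using recip_Icc[OF p] by (auto simp: reciprocal_in_L1_def AE_completion_iff)
    then have "AE s in lborel. s \<notin> {0..p}"
      by eventually_elim (use zero p in auto)
    then have "{0..p} \<in> null_sets lborel" by (subst AE_iff_null_sets) auto
    then show False using p by (simp add: null_sets_def)
  qed
  show "p \<noteq> 0 \<Longrightarrow> 0 < \<sigma> p"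
    using pos[of p] pos[of "-p"] \<sigma>_minus[of p] by (cases "0 < p") auto
qed

lemma C_pos: "0 < C"
proof (rule ccontr)
  assume "\<not> 0 < C"
  then have "C * \<bar>1\<bar> powr \<kappa> \<le> 0" by simp
  then show False using \<sigma>_le[of 1] \<sigma>_pos[of 1] by simp
qed

lemma \<sigma>_continuous: "continuous_on UNIV \<sigma>"
  unfolding continuous_on_def
proof
  fix q :: real
  have "(\<lambda>p. C * \<bar>\<bar>p\<bar> powr \<kappa> - \<bar>q\<bar> powr \<kappa>\<bar>) \<midarrow>q\<rightarrow> C * \<bar>\<bar>q\<bar> powr \<kappa> - \<bar>q\<bar> powr \<kappa>\<bar>"
    using \<kappa> by (intro tendsto_intros tendsto_powr') auto
  then have lim: "(\<lambda>p. C * \<bar>\<bar>p\<bar> powr \<kappa> - \<bar>q\<bar> powr \<kappa>\<bar>) \<midarrow>q\<rightarrow> 0" by simp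
  have "(\<lambda>p. \<sigma> p - \<sigma> q) \<midarrow>q\<rightarrow> 0"
    by (rule Lim_null_comparison[OF _ lim]) (simp add: \<sigma>_diff)
  then show "(\<sigma> \<longlongrightarrow> \<sigma> q) (at q within UNIV)" by (simp add: LIM_zero_iff)
qed

lemma \<sigma>_measurable [measurable]: "\<sigma> \<in> borel_measurable borel"
  by (rule borel_measurable_continuous_onI[OF \<sigma>_continuous])

lemma recip_integrable: "set_integrable lborel {p..q} (\<lambda>s. 1 / \<sigma> s)"
proof -
  define R where "R = max (max \<bar>p\<bar> \<bar>q\<bar>) 1"
  have "set_integrable lebesgue {-R..R} (\<lambda>s. 1 / \<sigma> s)"
    using recip_Icc[of R] by (simp add: R_def reciprocal_in_L1_def)
  then have "set_integrable lborel {-R..R} (\<lambda>s. 1 / \<sigma> s)"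
    unfolding set_integrable_def by (subst (asm) integrable_completion) auto
  then show ?thesis by (rule set_integrable_subset) (auto simp: R_def)
qed

lemma recip_interval_integrable: "interval_lebesgue_integrable lborel (ereal p) (ereal q) (\<lambda>s. 1 / \<sigma> s)"
  unfolding interval_lebesgue_integrable_def einterval_eq
  using recip_integrable[of p q] recip_integrable[of q p] by (auto intro: set_integrable_subset)

lemma phi_diff: "phi \<sigma> q - phi \<sigma> p = (LBINT s=p..q. 1 / \<sigma> s)"
proof -
  have "(LBINT s=ereal 0..ereal p. 1 / \<sigma> s) + (LBINT s=p..q. 1 / \<sigma> s) = (LBINT s=ereal 0..ereal q. 1 / \<sigma> s)"
  proof (rule interval_integral_sum)
    have "min (ereal 0) (min (ereal p) (ereal q)) = ereal (min 0 (min p q))"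
      "max (ereal 0) (max (ereal p) (ereal q)) = ereal (max 0 (max p q))"
      by (simp_all add: min_def max_def)
    then show "interval_lebesgue_integrable lborel (min (ereal 0) (min (ereal p) (ereal q)))
       (max (ereal 0) (max (ereal p) (ereal q))) (\<lambda>s. 1 / \<sigma> s)"
      by (simp only: recip_interval_integrable)
  qed
  then show ?thesis by (simp add: phi_def zero_ereal_def)
qed

lemma phi_0: "phi \<sigma> 0 = 0"
  by (simp add: phi_def zero_ereal_def[symmetric])

lemma phi_minus: "phi \<sigma> (- p) = - phi \<sigma> p"
proof -
  have "phi \<sigma> (- p) = (LBINT s=ereal 0..ereal (- p). 1 / \<sigma> s)" by (simp add: phi_def zero_ereal_def)
  also have "\<dots> = (LBINT s=ereal p..ereal 0. 1 / \<sigma> s)"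
    by (subst interval_integral_reflect) (simp add: \<sigma>_minus zero_ereal_def)
  also have "\<dots> = - phi \<sigma> p"
    by (subst interval_integral_endpoints_reverse) (simp add: phi_def zero_ereal_def)
  finally show ?thesis .
qed

lemma phi_diff_ge:
  assumes "0 \<le> p" "p \<le> q" "0 < q"
  shows "(q - p) / \<sigma> q \<le> phi \<sigma> q - phi \<sigma> p"
proof -
  have "(LBINT s:{p<..<q}. 1 / \<sigma> q) \<le> (LBINT s:{p<..<q}. 1 / \<sigma> s)"
  proof (rule set_integral_mono)
    show "set_integrable lborel {p<..<q} (\<lambda>s. 1 / \<sigma> s)"
      by (rule set_integrable_subset[OF recip_integrable[of p q]]) auto
    show "set_integrable lborel {p<..<q} (\<lambda>s. 1 / \<sigma> q)"
      unfolding set_integrable_def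
      by (intro integrable_scaleR_left impI integrable_real_indicator) (use assms in auto)
    show "1 / \<sigma> q \<le> 1 / \<sigma> s" if "s \<in> {p<..<q}" for s
      using that assms \<sigma>_pos[of s] mono_onD[OF \<sigma>_mono, of s q] by (intro divide_left_mono) auto
  qed
  moreover have "(LBINT s:{p<..<q}. 1 / \<sigma> q) = (q - p) / \<sigma> q"
    using assms by (simp add: set_lebesgue_integral_def)
  moreover have "phi \<sigma> q - phi \<sigma> p = (LBINT s:{p<..<q}. 1 / \<sigma> s)"
    using assms by (simp add: phi_diff interval_lebesgue_integral_def)
  ultimately show ?thesis by linarith
qed

lemma phi_less:
  assumes "p < q" shows "phi \<sigma> p < phi \<sigma> q"
proof -
  have pos: "phi \<sigma> p < phi \<sigma> q" if "0 \<le> p" "p < q" for p q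
    using phi_diff_ge[of p q] \<sigma>_pos[of q] that
    by (smt (verit) divide_pos_pos)
  consider "0 \<le> p" | "p < 0" "q \<le> 0" | "p < 0" "0 < q" by linarith
  then show ?thesis
  proof cases
    case 2
    then show ?thesis using pos[of "-q" "-p"] assms by (simp add: phi_minus)
  next
    case 3
    then show ?thesis using pos[of 0 "-p"] pos[of 0 q] by (simp add: phi_minus phi_0)
  qed (use pos assms in auto)
qed

lemma abs_phi_ge: "p \<noteq> 0 \<Longrightarrow> \<bar>p\<bar> / \<sigma> p \<le> \<bar>phi \<sigma> p\<bar>"
  using phi_diff_ge[of 0 p] phi_diff_ge[of 0 "-p"] \<sigma>_minus[of p]
  by (cases "0 < p") (auto simp: phi_0 phi_minus)

lemma phi_deriv: "p \<noteq> 0 \<Longrightarrow> (phi \<sigma> has_real_derivative 1 / \<sigma> p) (at p)"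
proof -
  assume p: "p \<noteq> 0"
  have "(phi \<sigma> has_vector_derivative 1 / \<sigma> p) (at p)"
  proof -
    define l where "l = p - \<bar>p\<bar> / 2"
    define u where "u = p + \<bar>p\<bar> / 2"
    have l: "l < p" "p < u" and nz: "\<And>s. s \<in> {l..u} \<Longrightarrow> s \<noteq> 0"
      using p by (auto simp: l_def u_def abs_if split: if_splits)
    have "continuous_on {l..u} (\<lambda>s. 1 / \<sigma> s)"
      using nz \<sigma>_pos by (intro continuous_intros continuous_on_subset[OF \<sigma>_continuous]) force+
    then have "((\<lambda>v. LBINT s=l..v. 1 / \<sigma> s) has_vector_derivative 1 / \<sigma> p) (at p within {l..u})"
      using l by (intro interval_integral_FTC2) auto
    then have "((\<lambda>v. phi \<sigma> v - phi \<sigma> l) has_vector_derivative 1 / \<sigma> p) (at p within {l..u})"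
      by (simp add: phi_diff)
    then have "((\<lambda>v. phi \<sigma> v - phi \<sigma> l) has_vector_derivative 1 / \<sigma> p) (at p)"
      using l by (subst (asm) at_within_Icc_at) auto
    then have "((\<lambda>v. phi \<sigma> v - phi \<sigma> l + phi \<sigma> l) has_vector_derivative 1 / \<sigma> p + 0) (at p)"
      by (intro has_vector_derivative_add has_vector_derivative_const)
    then show ?thesis by simp
  qed
  then show ?thesis by (simp add: has_real_derivative_iff_has_vector_derivative)
qed

lemma phi_continuous: "continuous_on UNIV (phi \<sigma>)"
proof -
  have "isCont (phi \<sigma>) p" for p
  proof -
    have int: "integral {p - 1..v} (\<lambda>s. 1 / \<sigma> s) = phi \<sigma> v - phi \<sigma> (p - 1)" if "v \<in> {p - 1..p + 1}" for v
      using that recip_integrable[of "p - 1" v]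
      by (simp add: phi_diff interval_integral_eq_integral)
    have "(\<lambda>s. 1 / \<sigma> s) integrable_on {p - 1..p + 1}"
      using recip_integrable by (rule set_borel_integral_eq_integral)
    then have "continuous_on {p - 1..p + 1} (\<lambda>v. integral {p - 1..v} (\<lambda>s. 1 / \<sigma> s))"
      by (rule indefinite_integral_continuous_1)
    then have "continuous_on {p - 1..p + 1} (\<lambda>v. phi \<sigma> v - phi \<sigma> (p - 1))"
      by (rule continuous_on_eq) (simp add: int)
    from continuous_on_add[OF this continuous_on_const[of _ "phi \<sigma> (p - 1)"]]
    have "continuous_on {p - 1..p + 1} (phi \<sigma>)" by simp
    then have "continuous_on {p - 1<..<p + 1} (phi \<sigma>)"
      by (rule continuous_on_subset) auto
    then show ?thesis
      by (simp add: continuous_on_eq_continuous_at)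
  qed
  then show ?thesis by (simp add: continuous_at_imp_continuous_on)
qed

text \<open>
  The lower bound \<open>q / \<sigma> q \<ge> q powr (1 - \<kappa>) / C\<close> of \<open>\<phi>\<close> is unbounded.
\<close>
lemma phi_surj: "\<exists>p. phi \<sigma> p = u"
proof -
  have pos: "\<exists>p. phi \<sigma> p = u" if u: "0 < u" for u
  proof -
    define q where "q = (C * u) powr (1 / (1 - \<kappa>))"
    have q: "0 < q" using C_pos u by (simp add: q_def)
    have "C * u = q powr (1 - \<kappa>)"
      using C_pos u \<kappa> by (simp add: q_def powr_powr)
    also have "\<dots> = q / q powr \<kappa>" using q by (simp add: powr_diff)
    finally have "u = q / (C * q powr \<kappa>)" using C_pos q by (simp add: field_simps)
    also have "\<dots> \<le> q / \<sigma> q"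
      using q \<sigma>_pos[of q] \<sigma>_le[of q] C_pos by (intro divide_left_mono) auto
    also have "\<dots> \<le> phi \<sigma> q" using phi_diff_ge[of 0 q] q by (simp add: phi_0)
    finally have "u \<le> phi \<sigma> q" .
    then show ?thesis
      using IVT'[of "phi \<sigma>" 0 u q] q u continuous_on_subset[OF phi_continuous] by (auto simp: phi_0)
  qed
  show ?thesis
  proof (cases u "0::real" rule: linorder_cases)
    case less
    with pos[of "-u"] obtain p where "phi \<sigma> p = - u" by auto
    then show ?thesis by (intro exI[of _ "-p"]) (simp add: phi_minus)
  qed (use pos phi_0 in auto)
qed

lemma phi_inj: "inj (phi \<sigma>)"
  by (rule injI) (metis phi_less less_irrefl linorder_cases)

abbreviation \<psi> :: "real \<Rightarrow> real" where "\<psi> \<equiv> inv (phi \<sigma>)"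

lemma phi_\<psi>: "phi \<sigma> (\<psi> u) = u"
proof (rule surj_f_inv_f)
  show "surj (phi \<sigma>)" unfolding surj_def by (intro allI) (metis phi_surj)
qed

lemma \<psi>_phi: "\<psi> (phi \<sigma> p) = p"
  by (rule inv_f_f[OF phi_inj])

lemma \<psi>_0: "\<psi> 0 = 0"
  using \<psi>_phi[of 0] by (simp add: phi_0)

lemma \<psi>_continuous: "isCont \<psi> u"
proof -
  have "isCont \<psi> (phi \<sigma> (\<psi> u))"
  proof (rule isCont_inverse_function[of 1 "\<psi> u" \<psi> "phi \<sigma>"])
    show "isCont (phi \<sigma>) z" for z
      using phi_continuous by (simp add: continuous_on_eq_continuous_at)
  qed (simp_all add: \<psi>_phi)
  then show ?thesis by (simp add: phi_\<psi>)
qed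

text \<open>
  At \<open>0\<close>, where the slope of \<open>\<phi>\<close> is infinite, \<open>\<bar>\<psi> h\<bar> \<le> \<sigma> (\<psi> h) * \<bar>h\<bar>\<close> by the lower bound of \<open>\<phi>\<close>,
  and \<open>\<sigma> (\<psi> h)\<close> tends to \<open>0\<close>.
\<close>
lemma \<psi>_deriv: "(\<psi> has_real_derivative \<sigma> (\<psi> u)) (at u)"
proof (cases "u = 0")
  case False
  then have nz: "\<psi> u \<noteq> 0" using phi_\<psi>[of u] phi_0 by metis
  have "(\<psi> has_real_derivative inverse (1 / \<sigma> (\<psi> u))) (at u)"
    by (rule DERIV_inverse_function[where f="phi \<sigma>" and a="u - 1" and b="u + 1"])
       (use nz phi_deriv \<sigma>_pos[of "\<psi> u"] in \<open>auto simp: phi_\<psi> \<psi>_continuous\<close>)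
  then show ?thesis by simp
next
  case True
  have "(\<lambda>h. \<psi> h / h) \<midarrow>0\<rightarrow> 0"
  proof (rule Lim_null_comparison)
    have "isCont (\<lambda>h. \<sigma> (\<psi> h)) 0"
      by (rule isCont_o2[OF \<psi>_continuous])
         (use \<sigma>_continuous in \<open>simp add: continuous_on_eq_continuous_at\<close>)
    then show "(\<lambda>h. \<sigma> (\<psi> h)) \<midarrow>0\<rightarrow> 0" by (simp add: isCont_def \<psi>_0 \<sigma>_0)
    have "\<bar>\<psi> h / h\<bar> \<le> \<sigma> (\<psi> h)" if "h \<noteq> 0" for h
    proof -
      have nz: "\<psi> h \<noteq> 0" using phi_\<psi>[of h] phi_0 that by metis
      then have "\<bar>\<psi> h\<bar> / \<sigma> (\<psi> h) \<le> \<bar>h\<bar>" using abs_phi_ge[of "\<psi> h"] by (simp add: phi_\<psi>)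
      then show ?thesis using \<sigma>_pos[OF nz] that by (simp add: field_simps)
    qed
    then show "\<forall>\<^sub>F h in at 0. norm (\<psi> h / h) \<le> \<sigma> (\<psi> h)"
      by (auto simp: eventually_at_filter)
  qed
  then show ?thesis using True by (simp add: DERIV_def \<psi>_0 \<sigma>_0)
qed

lemma \<psi>_Lipschitz:
  obtains L where "0 \<le> L" "\<And>p q. p \<in> {-R..R} \<Longrightarrow> q \<in> {-R..R} \<Longrightarrow> \<bar>\<psi> p - \<psi> q\<bar> \<le> L * \<bar>p - q\<bar>"
proof -
  have "continuous_on {-R..R} \<psi>"
    by (intro continuous_at_imp_continuous_on ballI \<psi>_continuous)
  then have "continuous_on {-R..R} (\<lambda>u. \<sigma> (\<psi> u))"
    by (rule continuous_on_compose2[OF \<sigma>_continuous]) simp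
  then have "bounded ((\<lambda>u. \<sigma> (\<psi> u)) ` {-R..R})"
    by (intro compact_imp_bounded compact_continuous_image) auto
  then obtain L where L: "0 < L" "\<And>u. u \<in> {-R..R} \<Longrightarrow> \<bar>\<sigma> (\<psi> u)\<bar> \<le> L"
    by (auto simp: bounded_pos)
  show ?thesis
  proof (rule that[of L])
    fix p q assume "p \<in> {-R..R}" "q \<in> {-R..R}"
    then have "norm (\<psi> p - \<psi> q) \<le> L * norm (p - q)"
      using L(2) by (intro field_differentiable_bound[of "{-R..R}" \<psi> "\<lambda>u. \<sigma> (\<psi> u)"])
        (auto intro: has_field_derivative_at_within \<psi>_deriv)
    then show "\<bar>\<psi> p - \<psi> q\<bar> \<le> L * \<bar>p - q\<bar>" by simp
  qed (use L in simp)
qed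

text \<open>
  Near a zero \<open>\<sigma> \<circ> \<psi>\<close> has only limited regularity; at the price of the singular weight it is as good
  as Hoelder of order \<open>\<kappa> + \<eta>\<close>.
\<close>
lemma \<sigma>_\<psi>_increment:
  assumes \<eta>: "0 < \<eta>" "\<eta> < 1 - \<kappa>"
  obtains A where "0 \<le> A"
    "\<And>p q. p \<in> {-R..R} \<Longrightarrow> q \<in> {-R..R} \<Longrightarrow> \<psi> q \<noteq> 0 \<Longrightarrow>
      \<bar>\<sigma> (\<psi> p) - \<sigma> (\<psi> q)\<bar> \<le> A / \<bar>\<psi> q\<bar> powr \<eta> * \<bar>p - q\<bar> powr (\<kappa> + \<eta>)"
proof -
  obtain L where L: "0 \<le> L" "\<And>p q. p \<in> {-R..R} \<Longrightarrow> q \<in> {-R..R} \<Longrightarrow> \<bar>\<psi> p - \<psi> q\<bar> \<le> L * \<bar>p - q\<bar>"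
    by (rule \<psi>_Lipschitz[of R]) (rule that)
  show ?thesis
  proof (rule that[of "C * L powr (\<kappa> + \<eta>)"])
    fix p q assume pq: "p \<in> {-R..R}" "q \<in> {-R..R}" and q: "\<psi> q \<noteq> 0"
    have "\<bar>\<sigma> (\<psi> p) - \<sigma> (\<psi> q)\<bar> \<le> C * \<bar>\<bar>\<psi> p\<bar> powr \<kappa> - \<bar>\<psi> q\<bar> powr \<kappa>\<bar>" by (rule \<sigma>_diff)
    also have "\<dots> \<le> C * (\<bar>\<psi> p - \<psi> q\<bar> powr (\<kappa> + \<eta>) / \<bar>\<psi> q\<bar> powr \<eta>)"
      using C_pos by (intro mult_left_mono abs_powr_diff_le \<kappa> \<eta> q) auto
    also have "\<dots> \<le> C * ((L * \<bar>p - q\<bar>) powr (\<kappa> + \<eta>) / \<bar>\<psi> q\<bar> powr \<eta>)"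
      using C_pos L(2)[OF pq] \<kappa> \<eta> by (intro mult_left_mono divide_right_mono powr_mono2) auto
    also have "\<dots> = C * L powr (\<kappa> + \<eta>) / \<bar>\<psi> q\<bar> powr \<eta> * \<bar>p - q\<bar> powr (\<kappa> + \<eta>)"
      using L(1) by (simp add: powr_mult)
    finally show "\<bar>\<sigma> (\<psi> p) - \<sigma> (\<psi> q)\<bar> \<le> C * L powr (\<kappa> + \<eta>) / \<bar>\<psi> q\<bar> powr \<eta> * \<bar>p - q\<bar> powr (\<kappa> + \<eta>)" .
  qed (use C_pos in simp)
qed

text \<open>
  The mean value inequality for \<open>\<psi> u - \<sigma> (\<psi> q) * u\<close>, whose derivative is the increment
  of \<open>\<sigma> \<circ> \<psi>\<close>. Only the value at \<open>q\<close> enters the weight; \<open>\<psi>\<close> may vanish between \<open>p\<close> and \<open>q\<close>.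
\<close>
lemma \<psi>_Taylor:
  assumes A: "0 \<le> A"
    "\<And>p q. p \<in> {-R..R} \<Longrightarrow> q \<in> {-R..R} \<Longrightarrow> \<psi> q \<noteq> 0 \<Longrightarrow>
      \<bar>\<sigma> (\<psi> p) - \<sigma> (\<psi> q)\<bar> \<le> A / \<bar>\<psi> q\<bar> powr \<eta> * \<bar>p - q\<bar> powr \<delta>"
    and pq: "p \<in> {-R..R}" "q \<in> {-R..R}" "\<psi> q \<noteq> 0" and \<delta>: "0 < \<delta>"
  shows "\<bar>\<psi> p - \<psi> q - \<sigma> (\<psi> q) * (p - q)\<bar> \<le> A / \<bar>\<psi> q\<bar> powr \<eta> * \<bar>p - q\<bar> powr (1 + \<delta>)"
proof -
  let ?S = "{min p q..max p q}"
  let ?B = "A / \<bar>\<psi> q\<bar> powr \<eta> * \<bar>p - q\<bar> powr \<delta>"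
  have "norm ((\<psi> p - \<sigma> (\<psi> q) * p) - (\<psi> q - \<sigma> (\<psi> q) * q)) \<le> ?B * norm (p - q)"
  proof (rule field_differentiable_bound[of ?S "\<lambda>u. \<psi> u - \<sigma> (\<psi> q) * u" "\<lambda>u. \<sigma> (\<psi> u) - \<sigma> (\<psi> q)"])
    fix u assume u: "u \<in> ?S"
    show "((\<lambda>u. \<psi> u - \<sigma> (\<psi> q) * u) has_field_derivative \<sigma> (\<psi> u) - \<sigma> (\<psi> q)) (at u within ?S)"
      using DERIV_diff[OF has_field_derivative_at_within[OF \<psi>_deriv] DERIV_cmult[OF DERIV_ident, of "\<sigma> (\<psi> q)"], of u ?S]
      by simp
    have "\<bar>\<sigma> (\<psi> u) - \<sigma> (\<psi> q)\<bar> \<le> A / \<bar>\<psi> q\<bar> powr \<eta> * \<bar>u - q\<bar> powr \<delta>"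
      using u pq by (intro A(2)) auto
    also have "\<dots> \<le> ?B"
      using u A(1) \<delta> by (intro mult_left_mono powr_mono2) auto
    finally show "norm (\<sigma> (\<psi> u) - \<sigma> (\<psi> q)) \<le> ?B" by simp
  qed auto
  moreover have "\<bar>p - q\<bar> powr (1 + \<delta>) = \<bar>p - q\<bar> powr \<delta> * \<bar>p - q\<bar>"
    by (cases "p = q") (simp_all add: powr_add mult.commute)
  moreover have "(\<psi> p - \<sigma> (\<psi> q) * p) - (\<psi> q - \<sigma> (\<psi> q) * q) = \<psi> p - \<psi> q - \<sigma> (\<psi> q) * (p - q)"
    by (simp add: right_diff_distrib)
  ultimately show ?thesis by (simp only: real_norm_def mult.assoc)
qed

end

section \<open>The chain rule along the driver\<close>

text \<open>
  The interval is \<open>[0, b]\<close>, where \<open>b\<close> is the time at which the equation is to be verified. The assumption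
  on the exponents expresses both that an admissible order \<open>\<alpha>\<close> exists and that the Taylor error is
  of smaller order than the step.
\<close>
locale holder_driver = power_coefficient \<sigma> \<kappa> C for \<sigma> \<kappa> C +
  fixes x :: "real \<Rightarrow> real" and b \<gamma> \<eta> K R A :: real
  assumes b: "0 < b" and \<gamma>: "0 < \<gamma>" "\<gamma> < 1"
    and \<eta>: "0 < \<eta>" "\<eta> < 1 - \<kappa>" and exponents: "1 < \<gamma> * (1 + \<kappa> + \<eta>)"
    and K: "0 \<le> K" and holder: "\<And>s t. s \<in> {0..b} \<Longrightarrow> t \<in> {0..b} \<Longrightarrow> \<bar>x t - x s\<bar> \<le> K * \<bar>t - s\<bar> powr \<gamma>"
    and x_0: "x 0 = 0" and x_range: "\<And>t. t \<in> {0..b} \<Longrightarrow> x t \<in> {-R..R}"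
    and A: "0 \<le> A"
    and A_bound: "\<And>p q. p \<in> {-R..R} \<Longrightarrow> q \<in> {-R..R} \<Longrightarrow> \<psi> q \<noteq> 0 \<Longrightarrow>
      \<bar>\<sigma> (\<psi> p) - \<sigma> (\<psi> q)\<bar> \<le> A / \<bar>\<psi> q\<bar> powr \<eta> * \<bar>p - q\<bar> powr (\<kappa> + \<eta>)"
    and recip_y: "reciprocal_in_L1 {0..b} (\<lambda>t. \<bar>\<psi> (x t)\<bar> powr \<eta>)"
begin

text \<open>
  The driver is extended by constants; beyond \<open>b\<close> this is what the forward differences of \<open>x\<close> need.
\<close>
definition X :: "real \<Rightarrow> real" where "X t = x (max 0 (min b t))"

definition y :: "real \<Rightarrow> real" where "y t = \<psi> (X t)"

text \<open>
  The midpoint of the interval of admissible orders.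
\<close>
definition \<alpha> :: real where "\<alpha> = (1 - \<gamma> + \<gamma> * (\<kappa> + \<eta>)) / 2"

definition F :: "real \<Rightarrow> real" where "F t = indicator {0..b} t * \<sigma> (y t)"

text \<open>
  The second factor \<open>x - x b\<close> of the fractional integral, reflected.
\<close>
definition G :: "real \<Rightarrow> real" where "G t = indicator {0..b} t * (X (b - t) - x b)"

definition m :: "real \<Rightarrow> real" where "m t = A * K powr (\<kappa> + \<eta>) / \<bar>y t\<bar> powr \<eta>"

lemma \<alpha>_bounds: "0 < \<alpha>" "\<alpha> < 1" "1 - \<alpha> < \<gamma>" "\<alpha> < \<gamma> * (\<kappa> + \<eta>)"
proof -
  have "\<gamma> * (\<kappa> + \<eta>) > 0" using \<gamma> \<kappa> \<eta> by simp
  moreover have "\<gamma> * (\<kappa> + \<eta>) < \<gamma> * 1" using \<gamma> \<eta> by (intro mult_strict_left_mono) auto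
  moreover have "1 < \<gamma> + \<gamma> * (\<kappa> + \<eta>)" using exponents by (simp add: algebra_simps)
  ultimately show "0 < \<alpha>" "\<alpha> < 1" "1 - \<alpha> < \<gamma>" "\<alpha> < \<gamma> * (\<kappa> + \<eta>)"
    using \<gamma> by (simp_all add: \<alpha>_def field_simps)
qed

lemma X_eq: "t \<in> {0..b} \<Longrightarrow> X t = x t"
  by (simp add: X_def)

lemma clamp_mem: "max 0 (min b t) \<in> {0..b}"
  using b by auto

lemma X_range: "X t \<in> {-R..R}"
  unfolding X_def by (rule x_range[OF clamp_mem])

lemma X_holder: "\<bar>X t - X s\<bar> \<le> K * \<bar>t - s\<bar> powr \<gamma>"
proof -
  have "\<bar>X t - X s\<bar> \<le> K * \<bar>max 0 (min b t) - max 0 (min b s)\<bar> powr \<gamma>"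
    unfolding X_def by (rule holder[OF clamp_mem clamp_mem])
  also have "\<dots> \<le> K * \<bar>t - s\<bar> powr \<gamma>"
    using K \<gamma> by (intro mult_left_mono powr_mono2) auto
  finally show ?thesis .
qed

lemma X_continuous: "isCont X t"
proof -
  have "(\<lambda>s. K * \<bar>s - t\<bar> powr \<gamma>) \<midarrow>t\<rightarrow> K * \<bar>t - t\<bar> powr \<gamma>"
    using \<gamma> by (intro tendsto_intros tendsto_powr') auto
  then have lim: "(\<lambda>s. K * \<bar>s - t\<bar> powr \<gamma>) \<midarrow>t\<rightarrow> 0" by simp
  have "(\<lambda>s. X s - X t) \<midarrow>t\<rightarrow> 0"
    by (rule Lim_null_comparison[OF _ lim]) (simp add: X_holder)
  then show ?thesis by (simp add: isCont_def LIM_zero_iff)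
qed

lemma y_continuous: "isCont y t"
  unfolding y_def[abs_def] by (rule isCont_o2[OF X_continuous \<psi>_continuous])

lemma \<sigma>_y_continuous: "isCont (\<lambda>t. \<sigma> (y t)) t"
  by (rule isCont_o2[OF y_continuous]) (use \<sigma>_continuous in \<open>simp add: continuous_on_eq_continuous_at\<close>)

lemma measurable_driver [measurable]:
  "X \<in> borel_measurable borel" "y \<in> borel_measurable borel"
  by (intro borel_measurable_continuous_onI continuous_at_imp_continuous_on ballI X_continuous y_continuous)+

lemma F_measurable [measurable]: "F \<in> borel_measurable borel"
  unfolding F_def[abs_def] by measurable

lemma G_measurable [measurable]: "G \<in> borel_measurable borel"
  unfolding G_def[abs_def] by measurable

lemma y_0: "y 0 = 0"
  using b by (simp add: y_def X_def x_0 \<psi>_0)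

lemma AE_y_nonzero: "AE t in lborel. t \<in> {0..b} \<longrightarrow> y t \<noteq> 0"
proof -
  have "AE t in lborel. t \<in> {0..b} \<longrightarrow> \<bar>\<psi> (x t)\<bar> powr \<eta> \<noteq> 0"
    using recip_y by (simp add: reciprocal_in_L1_def AE_completion_iff)
  then show ?thesis by eventually_elim (auto simp: y_def X_eq)
qed

lemma recip_y_integrable: "integrable lborel (\<lambda>t. indicator {0..b} t * (c / \<bar>y t\<bar> powr \<eta>))"
proof -
  have "set_integrable lebesgue {0..b} (\<lambda>t. 1 / \<bar>\<psi> (x t)\<bar> powr \<eta>)"
    using recip_y by (simp add: reciprocal_in_L1_def)
  also have "?this \<longleftrightarrow> integrable lebesgue (\<lambda>t. indicator {0..b} t * (1 / \<bar>y t\<bar> powr \<eta>))"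
    unfolding set_integrable_def
    by (intro Bochner_Integration.integrable_cong) (auto simp: y_def X_eq split: split_indicator)
  finally have "integrable lborel (\<lambda>t. indicator {0..b} t * (1 / \<bar>y t\<bar> powr \<eta>))"
    by (subst (asm) integrable_completion) auto
  from integrable_mult_right[OF this, of c] show ?thesis by (simp add: mult_ac)
qed

lemma \<sigma>_y_increment:
  assumes "y t \<noteq> 0"
  shows "\<bar>\<sigma> (y t) - \<sigma> (y s)\<bar> \<le> m t * \<bar>t - s\<bar> powr (\<gamma> * (\<kappa> + \<eta>))"
proof -
  have "\<bar>\<sigma> (y s) - \<sigma> (y t)\<bar> \<le> A / \<bar>y t\<bar> powr \<eta> * \<bar>X s - X t\<bar> powr (\<kappa> + \<eta>)"
    unfolding y_def using assms by (intro A_bound X_range) (simp add: y_def)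
  also have "\<dots> \<le> A / \<bar>y t\<bar> powr \<eta> * (K * \<bar>t - s\<bar> powr \<gamma>) powr (\<kappa> + \<eta>)"
    using A \<kappa> \<eta> X_holder[of s t] by (intro mult_left_mono powr_mono2) (auto simp: abs_minus_commute)
  also have "\<dots> = m t * \<bar>t - s\<bar> powr (\<gamma> * (\<kappa> + \<eta>))"
    using K by (simp add: m_def powr_mult powr_powr)
  finally show ?thesis by (simp add: abs_minus_commute)
qed

lemma y_Taylor:
  assumes "y t \<noteq> 0" "0 < e"
  shows "\<bar>y (t + e) - y t - \<sigma> (y t) * (X (t + e) - X t)\<bar>
    \<le> A * K powr (1 + \<kappa> + \<eta>) / \<bar>y t\<bar> powr \<eta> * e powr (\<gamma> * (1 + \<kappa> + \<eta>))"
proof -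
  have "\<bar>y (t + e) - y t - \<sigma> (y t) * (X (t + e) - X t)\<bar> \<le> A / \<bar>y t\<bar> powr \<eta> * \<bar>X (t + e) - X t\<bar> powr (1 + (\<kappa> + \<eta>))"
    unfolding y_def
    by (rule \<psi>_Taylor[OF A A_bound X_range X_range])
       (use assms(1) \<kappa> \<eta> in \<open>simp_all add: y_def\<close>)
  also have "\<dots> \<le> A / \<bar>y t\<bar> powr \<eta> * (K * e powr \<gamma>) powr (1 + (\<kappa> + \<eta>))"
    using A \<kappa> \<eta> X_holder[of "t + e" t] assms(2) by (intro mult_left_mono powr_mono2) auto
  also have "\<dots> = A * K powr (1 + \<kappa> + \<eta>) / \<bar>y t\<bar> powr \<eta> * e powr (\<gamma> * (1 + \<kappa> + \<eta>))"
    using K by (simp add: powr_mult powr_powr add.assoc)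
  finally show ?thesis .
qed

lemma ex_F_bound: "\<exists>B. \<forall>t. \<bar>F t\<bar> \<le> B"
proof -
  have "bounded ((\<lambda>t. \<sigma> (y t)) ` {0..b})"
    by (intro compact_imp_bounded compact_continuous_image continuous_at_imp_continuous_on ballI \<sigma>_y_continuous compact_Icc)
  then obtain B where "0 < B" "\<And>t. t \<in> {0..b} \<Longrightarrow> \<bar>\<sigma> (y t)\<bar> \<le> B" by (auto simp: bounded_pos)
  then show ?thesis by (intro exI[of _ B]) (auto simp: F_def split: split_indicator)
qed

lemma G_weighted_holder: "weighted_holder b (1 - \<alpha>) \<gamma> (K * b powr \<gamma>) G (\<lambda>_. K)"
  and G_increment: "t \<in> {0..b} \<Longrightarrow> s \<in> {0..t} \<Longrightarrow> \<bar>G t - G s\<bar> \<le> K * (t - s) powr \<gamma>"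
proof -
  show incr: "\<bar>G t - G s\<bar> \<le> K * (t - s) powr \<gamma>" if "t \<in> {0..b}" "s \<in> {0..t}" for t s
    using X_holder[of "b - t" "b - s"] that by (simp add: G_def abs_minus_commute[of s t])
  have G0: "G t = 0" if "t \<notin> {0<..b}" for t
    using that b by (auto simp: G_def X_def split: split_indicator)
  show "weighted_holder b (1 - \<alpha>) \<gamma> (K * b powr \<gamma>) G (\<lambda>_. K)"
  proof
    fix t show "\<bar>G t\<bar> \<le> K * b powr \<gamma>"
    proof (cases "t \<in> {0..b}")
      case True
      then have "\<bar>G t - G 0\<bar> \<le> K * (t - 0) powr \<gamma>" by (intro incr) auto
      also have "\<dots> \<le> K * b powr \<gamma>" using True K \<gamma> by (intro mult_left_mono powr_mono2) auto
      finally show ?thesis using G0[of 0] by simp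
    qed (use K in \<open>simp add: G_def\<close>)
    have "integrable lborel (\<lambda>t. K * indicator {0..b} t)"
      by (intro integrable_mult_right integrable_real_indicator) (auto simp: emeasure_lborel_Icc_eq)
    then show "integrable lborel (\<lambda>t. indicator {0..b} t * K)" by (simp add: mult.commute)
    show "AE t in lborel. t \<in> {0..b} \<longrightarrow> (\<forall>s\<in>{0..t}. \<bar>G t - G s\<bar> \<le> K * (t - s) powr \<gamma>)"
      using incr by (intro AE_I2) blast
  qed (use \<alpha>_bounds b K G0 in auto)
qed

lemma F_weighted_holder:
  assumes "\<And>t. \<bar>F t\<bar> \<le> B"
  shows "weighted_holder b \<alpha> (\<gamma> * (\<kappa> + \<eta>)) B F m"
proof
  show "F t = 0" if "t \<notin> {0<..b}" for t
    using that y_0 \<sigma>_0 by (cases "t = 0") (auto simp: F_def split: split_indicator)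
  show "integrable lborel (\<lambda>t. indicator {0..b} t * m t)"
    unfolding m_def by (rule recip_y_integrable)
  show "AE t in lborel. t \<in> {0..b} \<longrightarrow> (\<forall>s\<in>{0..t}. \<bar>F t - F s\<bar> \<le> m t * (t - s) powr (\<gamma> * (\<kappa> + \<eta>)))"
    using AE_y_nonzero
  proof eventually_elim
    case (elim t)
    show ?case
    proof (intro impI ballI)
      fix s assume "t \<in> {0..b}" "s \<in> {0..t}"
      then show "\<bar>F t - F s\<bar> \<le> m t * (t - s) powr (\<gamma> * (\<kappa> + \<eta>))"
        using \<sigma>_y_increment[of t s] elim by (auto simp: F_def)
    qed
  qed
qed (use assms \<alpha>_bounds b A in \<open>auto simp: m_def\<close>)

text \<open>
  The integral is a second-order difference of a primitive of \<open>y\<close>.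
\<close>
lemma average_increment_y_tendsto:
  "(\<lambda>n. (\<integral>s. indicator {0..b} s * (y (s + 1 / Suc n) - y s) \<partial>lborel) / (1 / Suc n)) \<longlonglongrightarrow> y b"
proof -
  define Y where "Y v = (LBINT s=ereal (-1)..ereal v. y s)" for v
  have Y: "(Y has_real_derivative y v) (at v)" if "v \<in> {0..b + 1}" for v
  proof -
    have "((\<lambda>v. LBINT s=ereal (-1)..ereal v. y s) has_vector_derivative y v) (at v within {-1..b + 2})"
      using that b by (intro interval_integral_FTC2 continuous_at_imp_continuous_on ballI y_continuous) auto
    then show ?thesis
      using that b by (simp add: Y_def[abs_def] has_real_derivative_iff_has_vector_derivative at_within_Icc_at)
  qed
  have int: "(\<integral>s. indicator {0..b} s * (y (s + e) - y s) \<partial>lborel) = (Y (b + e) - Y b) - (Y e - Y 0)"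
    if e: "0 < e" "e \<le> 1" for e
  proof -
    have "(\<integral>s. indicator {0..b} s *\<^sub>R (y (s + e) - y s) \<partial>lborel) = (Y (b + e) - Y b) - (Y (0 + e) - Y 0)"
    proof (rule integral_FTC_Icc)
      fix s assume s: "0 \<le> s" "s \<le> b"
      have "((\<lambda>s. Y (s + e)) has_real_derivative y (s + e)) (at s)"
        using Y[of "s + e"] s e by (subst DERIV_shift[symmetric]) auto
      then have "((\<lambda>s. Y (s + e) - Y s) has_real_derivative y (s + e) - y s) (at s)"
        using Y[of s] s by (intro DERIV_diff) auto
      then show "((\<lambda>s. Y (s + e) - Y s) has_vector_derivative y (s + e) - y s) (at s within {0..b})"
        by (simp add: has_real_derivative_iff_has_vector_derivative has_vector_derivative_at_within)
    next
      show "continuous_on {0..b} (\<lambda>s. y (s + e) - y s)"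
        by (intro continuous_at_imp_continuous_on ballI continuous_intros isCont_o2[OF _ y_continuous] y_continuous)
    qed (use b in simp)
    then show ?thesis by simp
  qed
  have dq: "(\<lambda>n. (Y (v + 1 / Suc n) - Y v) / (1 / Suc n)) \<longlonglongrightarrow> y v" if "v \<in> {0..b + 1}" for v
  proof -
    have "(\<lambda>h. (Y (v + h) - Y v) / h) \<midarrow>0\<rightarrow> y v" using Y[OF that] by (simp add: DERIV_def)
    moreover have "filterlim (\<lambda>n. 1 / Suc n) (at 0) sequentially"
      unfolding filterlim_at using LIMSEQ_inverse_real_of_nat by (auto simp: inverse_eq_divide)
    ultimately show ?thesis by (rule filterlim_compose)
  qed
  have "(\<lambda>n. (Y (b + 1 / Suc n) - Y b) / (1 / Suc n) - (Y (0 + 1 / Suc n) - Y 0) / (1 / Suc n)) \<longlonglongrightarrow> y b - y 0"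
    using b by (intro tendsto_diff dq) auto
  moreover have "(\<integral>s. indicator {0..b} s * (y (s + 1 / Suc n) - y s) \<partial>lborel) / (1 / Suc n)
      = (Y (b + 1 / Suc n) - Y b) / (1 / Suc n) - (Y (0 + 1 / Suc n) - Y 0) / (1 / Suc n)" for n
    by (subst int) (auto simp: left_diff_distrib)
  ultimately show ?thesis by (simp only: y_0 diff_zero)
qed

text \<open>
  Extending \<open>G\<close> by \<open>0\<close> to the left amounts to extending \<open>x\<close> by its value at \<open>b\<close> to the right.
\<close>
lemma convolve_difference:
  assumes e: "0 < e"
  shows "convolve G F b - convolve G F (b - e) = - (\<integral>s. indicator {0..b} s * (\<sigma> (y s) * (X (s + e) - X s)) \<partial>lborel)"
proof -
  obtain B where B: "\<And>t. \<bar>F t\<bar> \<le> B" using ex_F_bound by blast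
  interpret F: weighted_holder b \<alpha> "\<gamma> * (\<kappa> + \<eta>)" B F m by (rule F_weighted_holder[OF B])
  interpret G: weighted_holder b "1 - \<alpha>" \<gamma> "K * b powr \<gamma>" G "\<lambda>_. K" by (rule G_weighted_holder)
  have i: "integrable lborel (\<lambda>s. G (c - s) * F s)" for c
    by (rule Bochner_Integration.integrable_bound[OF integrable_mult_right[OF F.F_integrable, of "K * b powr \<gamma>"]])
       (use order_trans[OF G.F_bounded abs_ge_self] in \<open>auto simp: abs_mult intro!: AE_I2 mult_right_mono\<close>)
  have "convolve G F b - convolve G F (b - e) = (\<integral>s. G (b - s) * F s - G (b - e - s) * F s \<partial>lborel)"
    unfolding convolve_def using i by simp
  also have "\<dots> = (\<integral>s. - (indicator {0..b} s * (\<sigma> (y s) * (X (s + e) - X s))) \<partial>lborel)"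
  proof (rule Bochner_Integration.integral_cong[OF refl])
    fix s
    show "G (b - s) * F s - G (b - e - s) * F s = - (indicator {0..b} s * (\<sigma> (y s) * (X (s + e) - X s)))"
    proof (cases "s \<in> {0..b}")
      case True
      then have "G (b - s) = X s - x b" by (simp add: G_def)
      moreover have "G (b - e - s) = X (s + e) - x b"
        using True e by (auto simp: G_def X_def add.commute split: split_indicator)
      ultimately have "G (b - s) - G (b - e - s) = - (X (s + e) - X s)" by simp
      moreover have "G (b - s) * F s - G (b - e - s) * F s = (G (b - s) - G (b - e - s)) * F s"
        by (simp only: left_diff_distrib)
      ultimately have "G (b - s) * F s - G (b - e - s) * F s = - (X (s + e) - X s) * F s"
        by (simp only:)
      then show ?thesis using True by (simp add: F_def algebra_simps)
    qed (simp add: F_def)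
  qed
  finally show ?thesis by simp
qed

text \<open>
  The Taylor remainder integrates to at most \<open>M * e powr p\<close> with \<open>p = \<gamma> * (1 + \<kappa> + \<eta>) > 1\<close>, so in the limit of the
  quotients the increments of \<open>x\<close>, weighted by \<open>\<sigma> (y)\<close>, may be replaced by those of \<open>y\<close>.
\<close>
lemma forward_integral_tendsto:
  "(\<lambda>n. (convolve G F b - convolve G F (b - 1 / Suc n)) / (1 / Suc n)) \<longlonglongrightarrow> - y b"
proof -
  let ?I = "\<lambda>e. \<integral>s. indicator {0..b} s * (y (s + e) - y s) \<partial>lborel"
  let ?J = "\<lambda>e. \<integral>s. indicator {0..b} s * (\<sigma> (y s) * (X (s + e) - X s)) \<partial>lborel"
  let ?p = "\<gamma> * (1 + \<kappa> + \<eta>)"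
  define M where "M = (\<integral>s. indicator {0..b} s * (A * K powr (1 + \<kappa> + \<eta>) / \<bar>y s\<bar> powr \<eta>) \<partial>lborel)"
  have bound: "\<bar>?I e - ?J e\<bar> \<le> M * e powr ?p" if e: "0 < e" for e
  proof -
    have shift: "isCont (\<lambda>s. h (s + e)) s" if "\<And>s. isCont h s" for h :: "real \<Rightarrow> real" and s
      by (rule isCont_o2[OF _ that]) (auto intro!: continuous_intros)
    have int: "integrable lborel (\<lambda>s. indicator {0..b} s * h s)" if "\<And>s. isCont h s" for h :: "real \<Rightarrow> real"
      using borel_integrable_compact[of "{0..b}" h] that
      by (simp add: set_integrable_def continuous_at_imp_continuous_on)
    have iI: "integrable lborel (\<lambda>s. indicator {0..b} s * (y (s + e) - y s))"
      by (intro int continuous_intros shift y_continuous)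
    have iJ: "integrable lborel (\<lambda>s. indicator {0..b} s * (\<sigma> (y s) * (X (s + e) - X s)))"
      by (intro int continuous_intros shift \<sigma>_y_continuous X_continuous)
    have "\<bar>?I e - ?J e\<bar> = \<bar>\<integral>s. indicator {0..b} s * (y (s + e) - y s) - indicator {0..b} s * (\<sigma> (y s) * (X (s + e) - X s)) \<partial>lborel\<bar>"
      using iI iJ by simp
    also have "\<dots> \<le> (\<integral>s. \<bar>indicator {0..b} s * (y (s + e) - y s) - indicator {0..b} s * (\<sigma> (y s) * (X (s + e) - X s))\<bar> \<partial>lborel)"
      by (rule integral_abs_bound)
    also have "\<dots> \<le> (\<integral>s. indicator {0..b} s * (A * K powr (1 + \<kappa> + \<eta>) / \<bar>y s\<bar> powr \<eta>) * e powr ?p \<partial>lborel)"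
    proof (rule integral_mono_AE)
      show "AE s in lborel. \<bar>indicator {0..b} s * (y (s + e) - y s) - indicator {0..b} s * (\<sigma> (y s) * (X (s + e) - X s))\<bar>
          \<le> indicator {0..b} s * (A * K powr (1 + \<kappa> + \<eta>) / \<bar>y s\<bar> powr \<eta>) * e powr ?p"
        using AE_y_nonzero
      proof eventually_elim
        case (elim s)
        then show ?case using y_Taylor[of s e] e by (auto split: split_indicator)
      qed
    qed (intro integrable_abs Bochner_Integration.integrable_diff integrable_mult_left iI iJ recip_y_integrable)+
    also have "\<dots> = M * e powr ?p" unfolding M_def by (rule integral_mult_left_zero)
    finally show ?thesis .
  qed
  have lim: "(\<lambda>n. M * (1 / Suc n) powr (?p - 1)) \<longlonglongrightarrow> 0"
  proof -
    have "(\<lambda>n. 1 / Suc n) \<longlonglongrightarrow> (0 :: real)"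
      using LIMSEQ_inverse_real_of_nat by (simp add: inverse_eq_divide)
    then have "(\<lambda>n. (1 / Suc n) powr (?p - 1)) \<longlonglongrightarrow> 0"
      using exponents by (intro tendsto_zero_powrI[where b="?p - 1"]) auto
    then show ?thesis by (rule tendsto_mult_right_zero)
  qed
  have "(\<lambda>n. (?I (1 / Suc n) - ?J (1 / Suc n)) / (1 / Suc n)) \<longlonglongrightarrow> 0"
  proof (rule Lim_null_comparison[OF always_eventually lim], intro allI)
    fix n
    let ?e = "1 / Suc n :: real"
    have "\<bar>(?I ?e - ?J ?e) / ?e\<bar> = \<bar>?I ?e - ?J ?e\<bar> / ?e" by (simp add: abs_mult)
    also have "\<dots> \<le> M * ?e powr ?p / ?e" by (intro divide_right_mono bound) auto
    also have "\<dots> = M * ?e powr (?p - 1)" by (simp add: powr_diff)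
    finally show "norm ((?I ?e - ?J ?e) / ?e) \<le> M * ?e powr (?p - 1)" by simp
  qed
  from tendsto_diff[OF this average_increment_y_tendsto]
  have "(\<lambda>n. - ?J (1 / Suc n) / (1 / Suc n)) \<longlonglongrightarrow> - y b"
    by (simp add: left_diff_distrib)
  then show ?thesis by (simp add: convolve_difference)
qed

text \<open>
  The fractional integral is minus the pairing of the two derivatives, and both \<open>pairing_tendsto\<close>
  and \<open>forward_integral_tendsto\<close> compute the limit of the same quotients.
\<close>
theorem has_frac_integral_solution: "has_frac_integral (\<lambda>s. \<sigma> (\<psi> (x s))) x 0 b (\<psi> (x b))"
proof -
  obtain B where B: "\<And>t. \<bar>F t\<bar> \<le> B" using ex_F_bound by blast
  interpret F: weighted_holder b \<alpha> "\<gamma> * (\<kappa> + \<eta>)" B F m by (rule F_weighted_holder[OF B])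
  interpret G: weighted_holder b "1 - \<alpha>" \<gamma> "K * b powr \<gamma>" G "\<lambda>_. K" by (rule G_weighted_holder)
  interpret G: uniform_holder b "1 - \<alpha>" \<gamma> "K * b powr \<gamma>" G K
    by unfold_locales (use G_increment in \<open>auto simp: G.regular_at_def\<close>)
  interpret complementary_pair b \<alpha> "\<gamma> * (\<kappa> + \<eta>)" \<gamma> B "K * b powr \<gamma>" K F G m ..
  have F: "\<sigma> (\<psi> (x t)) = F t" if "t \<in> {0..b}" for t
    using that by (simp add: F_def y_def X_eq)
  have G: "x t - x b = G (b - t)" if "t \<in> {0..b}" for t
    using that by (simp add: G_def X_eq)
  have "(X \<longlongrightarrow> x b) (at_left b)"
    using X_continuous[of b] b by (auto simp: isCont_def X_def[of b] intro: tendsto_within_subset)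
  moreover have "\<forall>\<^sub>F t in at_left b. X t = x t"
    using eventually_at_left_real[OF b] by eventually_elim (auto simp: X_eq)
  ultimately have "(x \<longlongrightarrow> x b) (at_left b)" by (rule Lim_transform_eventually)
  moreover have i: "integrable lborel (\<lambda>r. G.D (b - r) * F.D r)"
    using G.abs_D_le by (intro integrable_D_mult) auto
  then have "integrable lborel (\<lambda>r. indicator {0..b} r * (F.D r * G.D (b - r)))"
    using integrable_mult_indicator[OF _ i, of "{0..b}"] by (simp add: mult_ac)
  then have "set_integrable lebesgue {0..b} (\<lambda>r. F.D r * G.D (b - r))"
    unfolding set_integrable_def by (simp add: integrable_completion)
  moreover have "\<psi> (x b) = - (LINT r:{0..b}|lebesgue. F.D r * G.D (b - r))"
  proof -
    have "(\<lambda>n. 1 / Suc n) \<longlonglongrightarrow> (0 :: real)"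
      using LIMSEQ_inverse_real_of_nat by (simp add: inverse_eq_divide)
    then have "(\<lambda>n. (convolve G F b - convolve G F (b - 1 / Suc n)) / (1 / Suc n)) \<longlonglongrightarrow> (\<integral>r. F.D r * G.D (b - r) \<partial>lborel)"
      by (intro pairing_tendsto) auto
    from LIMSEQ_unique[OF this forward_integral_tendsto]
    have "(\<integral>r. F.D r * G.D (b - r) \<partial>lborel) = - y b" .
    moreover have "(LINT r:{0..b}|lebesgue. F.D r * G.D (b - r)) = (\<integral>r. F.D r * G.D (b - r) \<partial>lborel)"
    proof -
      have "(LINT r:{0..b}|lebesgue. F.D r * G.D (b - r)) = (\<integral>r. F.D r * G.D (b - r) \<partial>lebesgue)"
        unfolding set_lebesgue_integral_def
        by (intro Bochner_Integration.integral_cong) (auto simp: F.D_supp split: split_indicator)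
      then show ?thesis by (simp add: integral_completion)
    qed
    ultimately show ?thesis using b by (simp add: y_def X_eq)
  qed
  ultimately show ?thesis
    unfolding has_frac_integral_def
    using b \<alpha>_bounds(1,2) F.mem_frac_image_left[OF F] F.has_frac_deriv_left[OF F]
      G.mem_frac_image_right[OF G] G.has_frac_deriv_right[OF G] by blast
qed

end

theorem theorem3p6:
  fixes T \<gamma> \<kappa> \<eta> :: real and \<sigma> x :: "real \<Rightarrow> real"
  assumes "T > 0"
    and "1 / 2 < \<gamma>" and "\<gamma> < 1"
    and "0 < \<kappa>" and "\<kappa> < 1"
    and "\<gamma> * (\<kappa> + 1) < 1"
    and "\<sigma> 0 = 0"
    and "\<exists>C. \<forall>\<xi>1 \<xi>2. \<bar>\<sigma> \<xi>2 - \<sigma> \<xi>1\<bar> \<le> C * \<bar>\<bar>\<xi>2\<bar> powr \<kappa> - \<bar>\<xi>1\<bar> powr \<kappa>\<bar>"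
    and "continuous_on {0..} \<sigma>" and "mono_on {0..} \<sigma>"
    and "\<forall>K. compact K \<and> 0 \<in> interior K \<longrightarrow> reciprocal_in_L1 K \<sigma>"
    and "(1 - \<gamma> * (1 + \<kappa>)) / \<gamma> < \<eta>" and "\<eta> < 1 - \<kappa>"
    and "holder_on \<gamma> {0..T} x" and "x 0 = 0"
    and "reciprocal_in_L1 {0..T} (\<lambda>t. \<bar>inv (phi \<sigma>) (x t)\<bar> powr \<eta>)"
  shows "\<forall>t\<in>{0..T}.
    has_frac_integral (\<lambda>s. \<sigma> (inv (phi \<sigma>) (x s))) x 0 t (inv (phi \<sigma>) (x t))"
proof
  fix t assume t: "t \<in> {0..T}"
  obtain C where C: "\<And>p q. \<bar>\<sigma> p - \<sigma> q\<bar> \<le> C * \<bar>\<bar>p\<bar> powr \<kappa> - \<bar>q\<bar> powr \<kappa>\<bar>"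
    using assms(8) by blast
  interpret power_coefficient \<sigma> \<kappa> C
    by unfold_locales (fact assms C)+
  show "has_frac_integral (\<lambda>s. \<sigma> (inv (phi \<sigma>) (x s))) x 0 t (inv (phi \<sigma>) (x t))"
  proof (cases "t = 0")
    case True
    then show ?thesis using \<open>x 0 = 0\<close> by (simp add: has_frac_integral_def \<psi>_0)
  next
    case False
    with t have t0: "0 < t" by simp
    have sub: "{0..t} \<subseteq> {0..T}" using t by auto
    obtain K where K: "\<And>r s. r \<in> {0..T} \<Longrightarrow> s \<in> {0..T} \<Longrightarrow> \<bar>x s - x r\<bar> \<le> K * \<bar>s - r\<bar> powr \<gamma>"
      using \<open>holder_on \<gamma> {0..T} x\<close> unfolding holder_on_def by blast
    have K0: "0 \<le> K"
    proof -
      have "0 \<le> K * \<bar>t - 0\<bar> powr \<gamma>" using K[of 0 t] t by (intro order_trans[OF abs_ge_zero]) auto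
      then show ?thesis using t0 by (simp add: zero_le_mult_iff)
    qed
    have pos: "0 < \<eta>" and exponents: "1 < \<gamma> * (1 + \<kappa> + \<eta>)"
    proof -
      have "0 < (1 - \<gamma> * (1 + \<kappa>)) / \<gamma>"
        using \<open>1 / 2 < \<gamma>\<close> \<open>\<gamma> * (\<kappa> + 1) < 1\<close> by (intro divide_pos_pos) (auto simp: algebra_simps)
      then show "0 < \<eta>" using assms(12) by simp
      show "1 < \<gamma> * (1 + \<kappa> + \<eta>)"
        using assms(2,12) by (simp add: field_simps)
    qed
    define R where "R = K * t powr \<gamma>"
    have range: "x s \<in> {-R..R}" if s: "s \<in> {0..t}" for s
    proof -
      have "\<bar>x s - x 0\<bar> \<le> K * \<bar>s - 0\<bar> powr \<gamma>" using s t by (intro K) auto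
      also have "\<dots> \<le> R" unfolding R_def using s K0 assms(2) by (intro mult_left_mono powr_mono2) auto
      finally show ?thesis using \<open>x 0 = 0\<close> by (auto simp: abs_le_iff)
    qed
    obtain A where A: "0 \<le> A"
      "\<And>p q. p \<in> {-R..R} \<Longrightarrow> q \<in> {-R..R} \<Longrightarrow> inv (phi \<sigma>) q \<noteq> 0 \<Longrightarrow>
        \<bar>\<sigma> (inv (phi \<sigma>) p) - \<sigma> (inv (phi \<sigma>) q)\<bar> \<le> A / \<bar>inv (phi \<sigma>) q\<bar> powr \<eta> * \<bar>p - q\<bar> powr (\<kappa> + \<eta>)"
      by (rule \<sigma>_\<psi>_increment[OF pos \<open>\<eta> < 1 - \<kappa>\<close>, of R]) (rule that)
    have recip: "reciprocal_in_L1 {0..t} (\<lambda>t. \<bar>inv (phi \<sigma>) (x t)\<bar> powr \<eta>)"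
      using assms(16) sub unfolding reciprocal_in_L1_def
      by (auto intro: set_integrable_subset elim!: eventually_mono)
    interpret holder_driver \<sigma> \<kappa> C x t \<gamma> \<eta> K R A
      by unfold_locales (use t0 assms(2,3,13,15) pos exponents K0 K sub range A recip in auto)
    show ?thesis by (rule has_frac_integral_solution)
  qed
qed

end
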